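(* Let $D=(V,A)$ be a digraph with no isolated nodes, $k\ge 2$ an integer, and $U\subseteq V$ a prescribed subset of nodes. The maximum cardinality of a $k$-sink-stable subset of $U$ is equal to $$\min\Big\{k\sum_{C\in\mathcal C}\eta(C)+\Big|U-\bigcup_{C\in\mathcal C}V(C)\Big| : \mathcal C \text{ a set of circuits of } D\Big\}.$$
   Context: Digraphs are finite; parallel and oppositely directed edges are allowed. A directed cut (dicut) of a digraph is the set of edges entering a subset $Z$ of nodes, provided no edge leaves $Z$. A sink node is a node with no leaving edge; a sink set is a set of nodes each of which is a sink. A set of nodes is sink-stable in $D$ if there are pairwise edge-disjoint dicuts of $D$ such that, after reversing the orientation of all edges of these dicuts, the set becomes a sink set. A set of nodes is $k$-sink-stable if it can be partitioned into $k$ sink-stable sets (possibly empty). A circuit $C$ of $D$ is a subdigraph whose underlying undirected graph is a circuit (connected with every degree equal to 2; its edges may be oriented arbitrarily, and two edges joining the same two nodes form a circuit); $V(C)$ is its node-set. Traversing $C$ in one of its two directions, each edge is forward or backward according to whether it is traversed along or against its orientation; $\eta(C)$ is the minimum of the number of forward edges and the number of backward edges of $C$. The set $\mathcal C$ may be empty. *)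

theory Defs
  imports "Graph_Theory.Digraph_Component"
begin

text \<open>
  Digraphs are the digraphs of \<open>Graph_Theory\<close>, finite by \<^locale>\<open>fin_digraph\<close>; parallel and
  oppositely directed arcs are allowed.  Loops are not excluded: a loop lies in no dicut, makes its
  end node a non-sink, and forms a circuit by itself.
\<close>

definition isolated :: "('a, 'b) pre_digraph \<Rightarrow> 'a \<Rightarrow> bool" where
  "isolated D v \<longleftrightarrow> v \<in> verts D \<and> in_arcs D v = {} \<and> out_arcs D v = {}"

definition dicut :: "('a, 'b) pre_digraph \<Rightarrow> 'b set \<Rightarrow> bool" where
  "dicut D B \<longleftrightarrow> (\<exists>Z \<subseteq> verts D.
     \<not> (\<exists>e \<in> arcs D. tail D e \<in> Z \<and> head D e \<notin> Z) \<and>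
     B = {e \<in> arcs D. tail D e \<notin> Z \<and> head D e \<in> Z})"

definition sink :: "('a, 'b) pre_digraph \<Rightarrow> 'a \<Rightarrow> bool" where
  "sink D v \<longleftrightarrow> v \<in> verts D \<and> out_arcs D v = {}"

definition sink_set :: "('a, 'b) pre_digraph \<Rightarrow> 'a set \<Rightarrow> bool" where
  "sink_set D S \<longleftrightarrow> (\<forall>v \<in> S. sink D v)"

definition reverse_arcs :: "('a, 'b) pre_digraph \<Rightarrow> 'b set \<Rightarrow> ('a, 'b) pre_digraph" where
  "reverse_arcs D B = \<lparr> verts = verts D, arcs = arcs D,
     tail = (\<lambda>e. if e \<in> B then head D e else tail D e),
     head = (\<lambda>e. if e \<in> B then tail D e else head D e) \<rparr>"

definition sink_stable :: "('a, 'b) pre_digraph \<Rightarrow> 'a set \<Rightarrow> bool" where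
  "sink_stable D S \<longleftrightarrow>
     (\<exists>\<B>. (\<forall>B \<in> \<B>. dicut D B) \<and> disjoint \<B> \<and> sink_set (reverse_arcs D (\<Union>\<B>)) S)"

definition k_sink_stable :: "('a, 'b) pre_digraph \<Rightarrow> nat \<Rightarrow> 'a set \<Rightarrow> bool" where
  "k_sink_stable D k S \<longleftrightarrow>
     (\<exists>P. (\<Union>i<k. P i) = S \<and> disjoint_family_on P {..<k} \<and> (\<forall>i<k. sink_stable D (P i)))"

text \<open>
  The sum of the in- and out-degree is the degree in the underlying undirected graph (a loop counts
  twice), and \<^const>\<open>Digraph_Component.connected\<close> is connectedness of that graph.
\<close>

definition circuit :: "('a, 'b) pre_digraph \<Rightarrow> ('a, 'b) pre_digraph \<Rightarrow> bool" where
  "circuit D C \<longleftrightarrow> subgraph C D \<and> Digraph_Component.connected C \<and>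
     (\<forall>v \<in> verts C. in_degree C v + out_degree C v = 2)"

text \<open>
  A step \<open>(e, True)\<close> runs through the arc \<open>e\<close> along its orientation (a forward arc), and
  \<open>(e, False)\<close> against it (a backward arc).
\<close>

fun step_start :: "('a, 'b) pre_digraph \<Rightarrow> 'b \<times> bool \<Rightarrow> 'a" where
  "step_start C (e, fwd) = (if fwd then tail C e else head C e)"

fun step_end :: "('a, 'b) pre_digraph \<Rightarrow> 'b \<times> bool \<Rightarrow> 'a" where
  "step_end C (e, fwd) = (if fwd then head C e else tail C e)"

text \<open>Closed sequences of consecutive steps that use every arc of \<open>C\<close> exactly once.\<close>

definition traversal :: "('a, 'b) pre_digraph \<Rightarrow> ('b \<times> bool) list \<Rightarrow> bool" where
  "traversal C w \<longleftrightarrow> distinct (map fst w) \<and> set (map fst w) = arcs C \<and>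
     (\<forall>i < length w. step_end C (w ! i) = step_start C (w ! (Suc i mod length w)))"

definition forward_arcs :: "('b \<times> bool) list \<Rightarrow> 'b set" where
  "forward_arcs w = {e. (e, True) \<in> set w}"

definition backward_arcs :: "('b \<times> bool) list \<Rightarrow> 'b set" where
  "backward_arcs w = {e. (e, False) \<in> set w}"

text \<open>
  For a circuit, the traversals differ only in the starting node and the direction, and changing
  the direction swaps forward and backward arcs; so the choice of the traversal does not matter.
\<close>

definition eta :: "('a, 'b) pre_digraph \<Rightarrow> nat" where
  "eta C = (let w = (SOME w. traversal C w) in
     min (card (forward_arcs w)) (card (backward_arcs w)))"

end

theory Submission
  imports Defs
begin

text \<open>
  A family of disjoint dicuts amounts to an integer potential that rises by \<open>0\<close> or \<open>1\<close> along each
  arc: the dicuts are the boundaries of its upper level sets.  A node is a sink after the reversal if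
  all arcs leaving it rise by \<open>1\<close> and all arcs entering it by \<open>0\<close>.  Adding the potentials of \<open>k\<close>
  disjoint sink-stable sets with union \<open>S\<close> gives a single potential \<open>p\<close> that rises by at least \<open>0\<close>
  and at most \<open>k\<close> along each arc, where each end of the arc in \<open>S\<close> sharpens one of the two bounds by one, and
  rounding \<open>(p + i) / k\<close> for \<open>i < k\<close> leads back (\<open>k_sink_stable_iff_potential\<close>).  So the maximum is
  taken over the solutions of a single system of difference constraints.

  Summing the constraints around a circuit gives \<open>card (S \<inter> verts C) \<le> k * eta C\<close>
  (\<open>card_inter_circuit_le\<close>), hence the inequality between maximum and minimum.

  For equality, the dual objects of difference constraints are circulations.  Consider circulations
  of steps along and against the arcs of \<open>D\<close>, where a step against an arc costs \<open>k\<close> and a node of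
  \<open>U\<close> that is missed costs \<open>1\<close>.  An integral circulation of minimum cost exists, as costs are
  natural numbers.  Since it cannot be improved along a cycle of its residual digraph, there is an
  integral potential for the marginal costs (\<open>optimal_circulation_potential\<close>); this potential defines
  a set \<open>S\<close>, and complementary slackness shows that \<open>S\<close> is at least as large as the minimum cost
  (\<open>sink_potential_from_optimal_circulation\<close>).  On the other hand the circulation decomposes into
  pairs of opposite steps through one arc and cycles that use each arc at most once.  A pair costs
  \<open>k \<ge> 2\<close> and serves at most two nodes, so it can be discarded.  The cycles are circuits, each with
  at least \<open>eta\<close> steps against an arc; so some set of circuits has at most the same value
  (\<open>circuits_from_circulation\<close>).
\<close>

section \<open>Closed walks and potentials\<close>

text \<open>
  Walks of a digraph are lists of arcs, with \<^const>\<open>pre_digraph.cas\<close> saying that consecutive arcs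
  fit together.  The bookkeeping along walks is done by telescoping sums of node potentials.
\<close>

lemma cas_append:
  "pre_digraph.cas G u (p @ q) v \<longleftrightarrow>
     (\<exists>x. pre_digraph.cas G u p x \<and> pre_digraph.cas G x q v)"
  by (induction p arbitrary: u) (auto simp: pre_digraph.cas.simps)

lemma cas_telescope:
  fixes \<phi> :: "'n \<Rightarrow> int"
  assumes "pre_digraph.cas G u p v"
  shows "(\<Sum>d\<leftarrow>p. \<phi> (head G d) - \<phi> (tail G d)) = \<phi> v - \<phi> u"
  using assms by (induction p arbitrary: u) (auto simp: pre_digraph.cas.simps)

definition simple_cycle :: "('n, 'd) pre_digraph \<Rightarrow> 'd list \<Rightarrow> bool" where
  "simple_cycle G p \<longleftrightarrow> p \<noteq> [] \<and> set p \<subseteq> arcs G \<and> distinct (map (tail G) p) \<and>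
     (\<exists>u. pre_digraph.cas G u p u)"

text \<open>
  The distance from a node to anywhere, over walks without a repeated node, is a minimum over a
  finite set.  Putting an arc \<open>d\<close> in front of a best walk from its head either gives another such
  walk, or closes a simple cycle; in the second case the rest of the walk is at least as good,
  since the cycle has nonnegative length.  So the negated distances satisfy all constraints.
\<close>

lemma potential_if_no_negative_cycle:
  fixes G :: "('n, 'd) pre_digraph" and c :: "'d \<Rightarrow> int"
  assumes fin: "finite (arcs G)"
    and nonneg: "\<And>p. simple_cycle G p \<Longrightarrow> 0 \<le> (\<Sum>d\<leftarrow>p. c d)"
  obtains \<pi> :: "'n \<Rightarrow> int" where "\<And>d. d \<in> arcs G \<Longrightarrow> \<pi> (head G d) - \<pi> (tail G d) \<le> c d"
proof -
  define cost where "cost p = (\<Sum>d\<leftarrow>p. c d)" for p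
  define P where "P u = {p. set p \<subseteq> arcs G \<and> distinct (map (tail G) p) \<and>
    (\<exists>v. pre_digraph.cas G u p v \<and> v \<notin> set (map (tail G) p))}" for u
  define \<rho> where "\<rho> u = Min (cost ` P u)" for u
  have finP: "finite (P u)" for u
  proof (rule finite_subset)
    show "P u \<subseteq> {p. set p \<subseteq> arcs G \<and> distinct p}"
      by (auto simp: P_def distinct_map)
    show "finite {p. set p \<subseteq> arcs G \<and> distinct p}"
      by (rule finite_subset_distinct[OF fin])
  qed
  have "[] \<in> P u" for u by (simp add: P_def pre_digraph.cas.simps)
  then have attained: "\<exists>p\<in>P u. cost p = \<rho> u" for u
    using Min_in[of "cost ` P u"] finP[of u] unfolding \<rho>_def by fastforce
  have lower: "\<rho> u \<le> cost p" if "p \<in> P u" for u p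
    unfolding \<rho>_def using finP that by auto
  have "\<rho> (tail G d) \<le> c d + \<rho> (head G d)" if d: "d \<in> arcs G" for d
  proof -
    obtain p where p: "p \<in> P (head G d)" "cost p = \<rho> (head G d)" using attained by blast
    obtain v where v: "set p \<subseteq> arcs G" "distinct (map (tail G) p)"
      "pre_digraph.cas G (head G d) p v" "v \<notin> set (map (tail G) p)"
      using p by (auto simp: P_def)
    show ?thesis
    proof (cases "tail G d \<in> set (map (tail G) p) \<or> tail G d = v")
      case False
      then have "d # p \<in> P (tail G d)"
        using v d by (auto simp: P_def pre_digraph.cas.simps)
      from lower[OF this] show ?thesis using p by (simp add: cost_def)
    next
      case True
      have "\<exists>p1 p2. p = p1 @ p2 \<and> pre_digraph.cas G (head G d) p1 (tail G d) \<and>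
        pre_digraph.cas G (tail G d) p2 v \<and> tail G d \<notin> set (map (tail G) p1)"
      proof (cases "tail G d = v")
        case True
        then show ?thesis using v by (intro exI[of _ p] exI[of _ "[]"]) (auto simp: pre_digraph.cas.simps)
      next
        case False
        then obtain x where x: "x \<in> set p" "tail G x = tail G d" using True by auto
        then obtain p1 p2 where p12: "p = p1 @ x # p2" by (meson split_list)
        then show ?thesis using v x
          by (intro exI[of _ p1] exI[of _ "x # p2"]) (auto simp: pre_digraph.cas.simps cas_append)
      qed
      then obtain p1 p2 where p12: "p = p1 @ p2"
        "pre_digraph.cas G (head G d) p1 (tail G d)" "pre_digraph.cas G (tail G d) p2 v"
        "tail G d \<notin> set (map (tail G) p1)" by blast
      have "simple_cycle G (d # p1)"
        using p12 v d by (auto simp: simple_cycle_def pre_digraph.cas.simps)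
      from nonneg[OF this] have "0 \<le> c d + cost p1" by (simp add: cost_def)
      moreover have "p2 \<in> P (tail G d)" using p12 v by (auto simp: P_def)
      then have "\<rho> (tail G d) \<le> cost p2" by (rule lower)
      moreover have "cost p = cost p1 + cost p2" by (simp add: cost_def p12)
      ultimately show ?thesis using p by simp
    qed
  qed
  then show ?thesis by (intro that[of "\<lambda>u. - \<rho> u"]) (simp add: algebra_simps)
qed

section \<open>Circulations of minimum convex cost\<close>

text \<open>
  The conservation law in weak form, tested against node potentials.  The potentials that are
  indicators of single nodes give inflow = outflow.
\<close>

definition circulation :: "('n, 'd) pre_digraph \<Rightarrow> ('d \<Rightarrow> nat) \<Rightarrow> bool" where
  "circulation G X \<longleftrightarrow>
     (\<forall>\<phi> :: 'n \<Rightarrow> int. (\<Sum>d\<in>arcs G. int (X d) * (\<phi> (head G d) - \<phi> (tail G d))) = 0)"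

lemma circulation_conservation:
  assumes "circulation G X" "finite (arcs G)"
  shows "(\<Sum>d\<in>in_arcs G v. X d) = (\<Sum>d\<in>out_arcs G v. X d)"
proof -
  have "(\<Sum>d\<in>arcs G. int (X d) * (of_bool (head G d = v) - of_bool (tail G d = v))) = 0"
    using assms(1)[unfolded circulation_def, rule_format, of "\<lambda>x. of_bool (x = v)"] by simp
  then have "(\<Sum>d\<in>arcs G. of_bool (head G d = v) * int (X d)) =
      (\<Sum>d\<in>arcs G. of_bool (tail G d = v) * int (X d))"
    by (simp add: algebra_simps sum_subtractf)
  moreover have "(\<Sum>d\<in>arcs G. of_bool (head G d = v) * int (X d)) = (\<Sum>d\<in>in_arcs G v. int (X d))"
    unfolding in_arcs_def using assms(2) by (intro sum.mono_neutral_cong_right) auto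
  moreover have "(\<Sum>d\<in>arcs G. of_bool (tail G d = v) * int (X d)) = (\<Sum>d\<in>out_arcs G v. int (X d))"
    unfolding out_arcs_def using assms(2) by (intro sum.mono_neutral_cong_right) auto
  ultimately show ?thesis by (metis of_nat_sum of_nat_eq_iff)
qed

text \<open>
  On a digraph without directed cycles the length \<open>-1\<close> of all arcs admits a potential, which makes
  the weak form of the conservation law strictly negative.  So a cycle can always be split off.
\<close>

lemma cycle_in_support_of_circulation:
  fixes G :: "('n, 'd) pre_digraph"
  assumes fin: "finite (arcs G)" and circ: "circulation G X" and pos: "d0 \<in> arcs G" "X d0 > 0"
  obtains p where "simple_cycle G p" "\<And>d. d \<in> set p \<Longrightarrow> X d > 0"
proof (rule ccontr)
  assume no: "\<not> thesis"
  let ?S = "G\<lparr>arcs := {d \<in> arcs G. X d > 0}\<rparr>"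
  have cas: "pre_digraph.cas ?S u p v \<longleftrightarrow> pre_digraph.cas G u p v" for u p v
    by (induction p arbitrary: u) (auto simp: pre_digraph.cas.simps)
  have "\<not> simple_cycle ?S p" for p
  proof
    assume "simple_cycle ?S p"
    then have "simple_cycle G p" "\<And>d. d \<in> set p \<Longrightarrow> X d > 0"
      by (auto simp: simple_cycle_def cas)
    with that no show False by blast
  qed
  then obtain \<pi> :: "'n \<Rightarrow> int" where
    \<pi>: "\<And>d. d \<in> arcs ?S \<Longrightarrow> \<pi> (head ?S d) - \<pi> (tail ?S d) \<le> (\<lambda>_. -1) d"
    using fin by (elim potential_if_no_negative_cycle[of ?S "\<lambda>_. -1", rotated 2]) auto
  have "(\<Sum>d\<in>arcs G. int (X d) * (\<pi> (head G d) - \<pi> (tail G d))) \<le> (\<Sum>d\<in>arcs G. - int (X d))"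
  proof (rule sum_mono)
    fix d assume "d \<in> arcs G"
    then show "int (X d) * (\<pi> (head G d) - \<pi> (tail G d)) \<le> - int (X d)"
      using \<pi>[of d] mult_left_mono[of "\<pi> (head G d) - \<pi> (tail G d)" "-1" "int (X d)"]
      by (cases "X d > 0") auto
  qed
  also have "\<dots> \<le> - int (X d0)"
    using member_le_sum[of d0 "arcs G" "\<lambda>d. int (X d)"] fin pos by (simp add: sum_negf)
  also have "\<dots> < 0" using pos by simp
  finally show False using circ by (simp add: circulation_def)
qed

text \<open>
  The walks of \<open>bidirected G\<close> are those of the underlying undirected graph: its arcs are the steps
  along and against the arcs of \<open>G\<close>.
\<close>

definition bidirected :: "('n, 'd) pre_digraph \<Rightarrow> ('n, 'd \<times> bool) pre_digraph" where
  "bidirected G = \<lparr> verts = verts G, arcs = arcs G \<times> UNIV,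
     tail = step_start G, head = step_end G \<rparr>"

lemma bidirected_simps [simp]:
  "verts (bidirected G) = verts G" "arcs (bidirected G) = arcs G \<times> UNIV"
  "tail (bidirected G) = step_start G" "head (bidirected G) = step_end G"
  by (simp_all add: bidirected_def)

lemma sum_set_of_steps:
  fixes g :: "'e \<times> bool \<Rightarrow> 'm :: comm_semiring_1"
  assumes "finite E" "A \<subseteq> E \<times> UNIV"
  shows "sum g A = (\<Sum>e\<in>E. of_bool ((e, True) \<in> A) * g (e, True) + of_bool ((e, False) \<in> A) * g (e, False))"
proof -
  have pair: "(\<Sum>b\<in>UNIV. f b) = f True + f False" for f :: "bool \<Rightarrow> 'm"
    by (simp add: UNIV_bool add.commute)
  have "sum g A = (\<Sum>d\<in>E \<times> UNIV. of_bool (d \<in> A) * g d)"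
    using assms by (intro sum.mono_neutral_cong_left) auto
  also have "\<dots> = (\<Sum>e\<in>E. \<Sum>b\<in>UNIV. of_bool ((e, b) \<in> A) * g (e, b))"
    unfolding sum.cartesian_product by (rule sum.cong) auto
  finally show ?thesis unfolding pair .
qed

text \<open>
  The optimality criterion: pushing one unit along a simple cycle of the residual digraph cannot
  lower the cost, hence that digraph, with the marginal costs as lengths, has a potential.
  Convexity takes care of a residual cycle that uses the two opposite steps of one arc: then the
  circulation does not change on that arc, while the sum of the two marginal costs is nonnegative.
\<close>

lemma optimal_circulation_potential:
  fixes G :: "('n, 'd) pre_digraph" and h :: "'d \<Rightarrow> nat \<Rightarrow> int"
  assumes fin: "finite (arcs G)" and circ: "circulation G X"
    and convex: "\<And>d n. d \<in> arcs G \<Longrightarrow> h d (Suc n) - h d n \<le> h d (Suc (Suc n)) - h d (Suc n)"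
    and opt: "\<And>Y. circulation G Y \<Longrightarrow> (\<Sum>d\<in>arcs G. h d (X d)) \<le> (\<Sum>d\<in>arcs G. h d (Y d))"
  obtains \<pi> :: "'n \<Rightarrow> int" where
    "\<And>d. d \<in> arcs G \<Longrightarrow> \<pi> (head G d) - \<pi> (tail G d) \<le> h d (Suc (X d)) - h d (X d)"
    "\<And>d. d \<in> arcs G \<Longrightarrow> X d > 0 \<Longrightarrow> h d (X d) - h d (X d - 1) \<le> \<pi> (head G d) - \<pi> (tail G d)"
proof -
  define R where "R = (bidirected G)\<lparr>arcs := {(d, b). d \<in> arcs G \<and> (b \<or> X d > 0)}\<rparr>"
  define c where "c = (\<lambda>(d, b). if b then h d (Suc (X d)) - h d (X d) else h d (X d - 1) - h d (X d))"
  have R [simp]: "arcs R = {(d, b). d \<in> arcs G \<and> (b \<or> X d > 0)}"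
    "tail R = step_start G" "head R = step_end G" by (auto simp: R_def)
  have finR: "finite (arcs R)"
    by (rule finite_subset[of _ "arcs G \<times> UNIV"]) (use fin in auto)
  have "0 \<le> (\<Sum>d\<leftarrow>p. c d)" if p: "simple_cycle R p" for p
  proof -
    obtain u where u: "pre_digraph.cas R u p u" using p by (auto simp: simple_cycle_def)
    have dist: "distinct p" using p by (auto simp: simple_cycle_def distinct_map)
    have sub: "set p \<subseteq> arcs G \<times> UNIV" using p by (auto simp: simple_cycle_def)
    have pos: "X d > 0" if "(d, False) \<in> set p" for d using p that by (auto simp: simple_cycle_def)
    \<comment> \<open>the circulation after pushing one unit along \<open>p\<close>\<close>
    define Y where "Y d = X d + of_bool ((d, True) \<in> set p) - of_bool ((d, False) \<in> set p)" for d
    have Y: "int (Y d) = int (X d) + of_bool ((d, True) \<in> set p) - of_bool ((d, False) \<in> set p)" for d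
      using pos[of d] by (auto simp: Y_def)
    have "circulation G Y"
      unfolding circulation_def
    proof
      fix \<phi> :: "'n \<Rightarrow> int"
      have "0 = (\<Sum>d\<leftarrow>p. \<phi> (head R d) - \<phi> (tail R d))"
        using cas_telescope[OF u, of \<phi>] by simp
      also have "\<dots> = (\<Sum>d\<in>set p. \<phi> (head R d) - \<phi> (tail R d))"
        by (rule sum_list_distinct_conv_sum_set[OF dist])
      also have "\<dots> = (\<Sum>d\<in>arcs G. (of_bool ((d, True) \<in> set p) - of_bool ((d, False) \<in> set p)) *
          (\<phi> (head G d) - \<phi> (tail G d)))"
        by (subst sum_set_of_steps[OF fin sub]) (auto intro!: sum.cong simp: algebra_simps)
      finally have "(\<Sum>d\<in>arcs G. (of_bool ((d, True) \<in> set p) - of_bool ((d, False) \<in> set p)) *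
          (\<phi> (head G d) - \<phi> (tail G d))) = 0" by simp
      moreover have "(\<Sum>d\<in>arcs G. int (X d) * (\<phi> (head G d) - \<phi> (tail G d))) = 0"
        using circ by (simp add: circulation_def)
      ultimately show "(\<Sum>d\<in>arcs G. int (Y d) * (\<phi> (head G d) - \<phi> (tail G d))) = 0"
        unfolding Y by (simp add: algebra_simps sum.distrib sum_subtractf)
    qed
    from opt[OF this] have "0 \<le> (\<Sum>d\<in>arcs G. h d (Y d) - h d (X d))" by (simp add: sum_subtractf)
    also have "\<dots> \<le> (\<Sum>d\<in>arcs G. of_bool ((d, True) \<in> set p) * c (d, True) +
        of_bool ((d, False) \<in> set p) * c (d, False))"
    proof (rule sum_mono)
      fix d assume d: "d \<in> arcs G"
      show "h d (Y d) - h d (X d) \<le> of_bool ((d, True) \<in> set p) * c (d, True) +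
        of_bool ((d, False) \<in> set p) * c (d, False)"
        using pos[of d] convex[OF d, of "X d - 1"] by (auto simp: Y_def c_def)
    qed
    also have "\<dots> = (\<Sum>d\<in>set p. c d)" by (rule sum_set_of_steps[OF fin sub, symmetric])
    also have "\<dots> = (\<Sum>d\<leftarrow>p. c d)" by (rule sum_list_distinct_conv_sum_set[OF dist, symmetric])
    finally show ?thesis .
  qed
  then obtain \<pi> :: "'n \<Rightarrow> int" where
    \<pi>: "\<And>d. d \<in> arcs R \<Longrightarrow> \<pi> (head R d) - \<pi> (tail R d) \<le> c d"
    using potential_if_no_negative_cycle[OF finR, of c] by blast
  show ?thesis
  proof (rule that[of \<pi>])
    fix d assume d: "d \<in> arcs G"
    show "\<pi> (head G d) - \<pi> (tail G d) \<le> h d (Suc (X d)) - h d (X d)"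
      using \<pi>[of "(d, True)"] d by (simp add: c_def)
    assume "X d > 0"
    then show "h d (X d) - h d (X d - 1) \<le> \<pi> (head G d) - \<pi> (tail G d)"
      using \<pi>[of "(d, False)"] d by (simp add: c_def)
  qed
qed

section \<open>Sink-stability in terms of potentials\<close>

lemma sink_set_reverse_arcs_iff:
  "sink_set (reverse_arcs D R) S \<longleftrightarrow> S \<subseteq> verts D \<and>
     (\<forall>e \<in> arcs D. (tail D e \<in> S \<longrightarrow> e \<in> R) \<and> (head D e \<in> S \<longrightarrow> e \<notin> R))"
proof -
  have "sink (reverse_arcs D R) v \<longleftrightarrow> v \<in> verts D \<and>
     (\<forall>e \<in> arcs D. (tail D e = v \<longrightarrow> e \<in> R) \<and> (head D e = v \<longrightarrow> e \<notin> R))" for v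
    unfolding sink_def reverse_arcs_def out_arcs_def by simp blast
  then show ?thesis unfolding sink_set_def by blast
qed

text \<open>
  A family of disjoint dicuts is encoded by an integer potential that rises by \<open>0\<close> or \<open>1\<close> along
  each arc: the potential of a node counts the dicuts whose set \<open>Z\<close> contains it, and conversely
  the upper level sets of a potential give the dicuts.  The reversed arcs are those with rise \<open>1\<close>;
  a node becomes a sink if they include all arcs leaving it and none of those entering it.
\<close>

lemma sink_stable_iff_potential:
  fixes D :: "('a, 'b) pre_digraph"
  assumes fin: "fin_digraph D" and S: "S \<subseteq> verts D"
  shows "sink_stable D S \<longleftrightarrow> (\<exists>\<pi> :: 'a \<Rightarrow> int. \<forall>e \<in> arcs D.
     of_bool (tail D e \<in> S) \<le> \<pi> (head D e) - \<pi> (tail D e) \<and>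
     \<pi> (head D e) - \<pi> (tail D e) \<le> 1 - of_bool (head D e \<in> S))"
proof
  interpret fin_digraph D by (rule fin)
  assume "sink_stable D S"
  then obtain \<B> where \<B>: "\<And>B. B \<in> \<B> \<Longrightarrow> dicut D B" "disjoint \<B>"
    "sink_set (reverse_arcs D (\<Union>\<B>)) S" unfolding sink_stable_def by blast
  have "\<B> \<subseteq> Pow (arcs D)" using \<B>(1) unfolding dicut_def by blast
  then have fin\<B>: "finite \<B>" by (rule finite_subset) simp
  have "\<forall>B \<in> \<B>. \<exists>Z. (\<forall>e \<in> arcs D. tail D e \<in> Z \<longrightarrow> head D e \<in> Z) \<and>
      (\<forall>e \<in> arcs D. e \<in> B \<longleftrightarrow> tail D e \<notin> Z \<and> head D e \<in> Z)"
    using \<B>(1) unfolding dicut_def by blast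
  then obtain Z where Z: "\<And>B e. B \<in> \<B> \<Longrightarrow> e \<in> arcs D \<Longrightarrow> tail D e \<in> Z B \<Longrightarrow> head D e \<in> Z B"
    "\<And>B e. B \<in> \<B> \<Longrightarrow> e \<in> arcs D \<Longrightarrow> e \<in> B \<longleftrightarrow> tail D e \<notin> Z B \<and> head D e \<in> Z B"
    by metis
  define \<pi> where "\<pi> v = (\<Sum>B\<in>\<B>. of_bool (v \<in> Z B) :: int)" for v
  have rise: "\<pi> (head D e) - \<pi> (tail D e) = of_bool (e \<in> \<Union>\<B>)" if e: "e \<in> arcs D" for e
  proof -
    have "\<pi> (head D e) - \<pi> (tail D e) = (\<Sum>B\<in>\<B>. of_bool (e \<in> B))"
      unfolding \<pi>_def sum_subtractf[symmetric]
    proof (rule sum.cong)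
      fix B assume B: "B \<in> \<B>"
      show "of_bool (head D e \<in> Z B) - of_bool (tail D e \<in> Z B) = (of_bool (e \<in> B) :: int)"
        using Z[OF B e] by auto
    qed simp
    also have "\<dots> = of_bool (e \<in> \<Union>\<B>)"
    proof (cases "e \<in> \<Union>\<B>")
      case True
      then obtain B0 where B0: "B0 \<in> \<B>" "e \<in> B0" by blast
      then have "(\<Sum>B\<in>\<B>. of_bool (e \<in> B) :: int) = (\<Sum>B\<in>{B0}. of_bool (e \<in> B))"
        using \<B>(2) fin\<B> by (intro sum.mono_neutral_right) (auto simp: pairwise_def disjnt_def)
      then show ?thesis using B0 True by simp
    qed (auto intro: sum.neutral)
    finally show ?thesis .
  qed
  have "e \<in> \<Union>\<B>" if "e \<in> arcs D" "tail D e \<in> S" for e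
    using \<B>(3) that unfolding sink_set_reverse_arcs_iff by blast
  moreover have "e \<notin> \<Union>\<B>" if "e \<in> arcs D" "head D e \<in> S" for e
    using \<B>(3) that unfolding sink_set_reverse_arcs_iff by blast
  ultimately show "\<exists>\<pi> :: 'a \<Rightarrow> int. \<forall>e \<in> arcs D.
     of_bool (tail D e \<in> S) \<le> \<pi> (head D e) - \<pi> (tail D e) \<and>
     \<pi> (head D e) - \<pi> (tail D e) \<le> 1 - of_bool (head D e \<in> S)"
    using rise by (intro exI[of _ \<pi>]) auto
next
  interpret fin_digraph D by (rule fin)
  assume "\<exists>\<pi> :: 'a \<Rightarrow> int. \<forall>e \<in> arcs D.
     of_bool (tail D e \<in> S) \<le> \<pi> (head D e) - \<pi> (tail D e) \<and>
     \<pi> (head D e) - \<pi> (tail D e) \<le> 1 - of_bool (head D e \<in> S)"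
  then obtain \<pi> :: "'a \<Rightarrow> int" where
    lo: "\<And>e. e \<in> arcs D \<Longrightarrow> of_bool (tail D e \<in> S) \<le> \<pi> (head D e) - \<pi> (tail D e)" and
    up: "\<And>e. e \<in> arcs D \<Longrightarrow> \<pi> (head D e) - \<pi> (tail D e) \<le> 1 - of_bool (head D e \<in> S)"
    by blast
  have step: "\<pi> (head D e) = \<pi> (tail D e) \<or> \<pi> (head D e) = \<pi> (tail D e) + 1" if "e \<in> arcs D" for e
    using lo[OF that] up[OF that] by (auto split: if_splits simp: of_bool_def)
  define cut where "cut j = {e \<in> arcs D. \<pi> (tail D e) < j \<and> j \<le> \<pi> (head D e)}" for j
  have "dicut D (cut j)" for j
    unfolding dicut_def
  proof (intro exI conjI)
    show "{v \<in> verts D. j \<le> \<pi> v} \<subseteq> verts D" by blast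
    show "\<not> (\<exists>e\<in>arcs D. tail D e \<in> {v \<in> verts D. j \<le> \<pi> v} \<and> head D e \<notin> {v \<in> verts D. j \<le> \<pi> v})"
      using step wellformed by fastforce
    show "cut j = {e \<in> arcs D. tail D e \<notin> {v \<in> verts D. j \<le> \<pi> v} \<and> head D e \<in> {v \<in> verts D. j \<le> \<pi> v}}"
      by (auto simp: cut_def)
  qed
  moreover have "cut i \<inter> cut j = {}" if "i \<noteq> j" for i j
  proof -
    have "j = \<pi> (head D e)" if "e \<in> cut j" for e j
      using that step[of e] by (auto simp: cut_def)
    then show ?thesis using that by blast
  qed
  then have "disjoint (range cut)" by (intro disjointI) (metis imageE)
  moreover have "sink_set (reverse_arcs D (\<Union>(range cut))) S"
    unfolding sink_set_reverse_arcs_iff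
  proof (intro conjI ballI impI S)
    fix e assume e: "e \<in> arcs D"
    have "e \<in> \<Union>(range cut) \<longleftrightarrow> (\<exists>j. \<pi> (tail D e) < j \<and> j \<le> \<pi> (head D e))"
      using e by (simp add: cut_def)
    then have mem: "e \<in> \<Union>(range cut) \<longleftrightarrow> \<pi> (tail D e) < \<pi> (head D e)"
      by (meson less_le_trans order_refl)
    show "e \<in> \<Union>(range cut)" if "tail D e \<in> S" using lo[OF e] that mem by simp
    show "e \<notin> \<Union>(range cut)" if "head D e \<in> S" using up[OF e] that mem by simp
  qed
  ultimately show "sink_stable D S" unfolding sink_stable_def by blast
qed

text \<open>
  The \<open>k\<close> potentials of a partition into sink-stable sets add up to a single potential \<open>p\<close>.
  Conversely \<open>p\<close> is the sum of the \<open>k\<close> functions \<open>\<lfloor>(p + i) / k\<rfloor>\<close> for \<open>i < k\<close>.  As \<open>i\<close> runs through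
  its range, the sum \<open>p v + i\<close> takes the residue \<open>-1\<close> modulo \<open>k\<close> exactly once.  At that residue an
  increase of \<open>p\<close> by one already increases the quotient, while a decrease by up to \<open>k - 1\<close> leaves
  it unchanged; so this \<open>i\<close> is the class to which \<open>v\<close> can be assigned.
\<close>

lemma k_sink_stable_iff_potential:
  fixes D :: "('a, 'b) pre_digraph"
  assumes fin: "fin_digraph D" and S: "S \<subseteq> verts D" and k: "k > 0"
  shows "k_sink_stable D k S \<longleftrightarrow> (\<exists>p :: 'a \<Rightarrow> int. \<forall>e \<in> arcs D.
     of_bool (tail D e \<in> S) \<le> p (head D e) - p (tail D e) \<and>
     p (head D e) - p (tail D e) \<le> int k - of_bool (head D e \<in> S))"
proof
  assume "k_sink_stable D k S"
  then obtain P where P: "(\<Union>i<k. P i) = S" "disjoint_family_on P {..<k}"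
    "\<And>i. i < k \<Longrightarrow> sink_stable D (P i)" by (auto simp: k_sink_stable_def)
  have "P i \<subseteq> verts D" if "i < k" for i using P(1) S that by blast
  then have "\<forall>i\<in>{..<k}. \<exists>\<pi> :: 'a \<Rightarrow> int. \<forall>e \<in> arcs D.
     of_bool (tail D e \<in> P i) \<le> \<pi> (head D e) - \<pi> (tail D e) \<and>
     \<pi> (head D e) - \<pi> (tail D e) \<le> 1 - of_bool (head D e \<in> P i)"
    using P(3) sink_stable_iff_potential[OF fin] by simp
  then obtain \<pi> :: "nat \<Rightarrow> 'a \<Rightarrow> int" where
    lo: "\<And>i e. i < k \<Longrightarrow> e \<in> arcs D \<Longrightarrow> of_bool (tail D e \<in> P i) \<le> \<pi> i (head D e) - \<pi> i (tail D e)" and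
    up: "\<And>i e. i < k \<Longrightarrow> e \<in> arcs D \<Longrightarrow> \<pi> i (head D e) - \<pi> i (tail D e) \<le> 1 - of_bool (head D e \<in> P i)"
    by (metis lessThan_iff)
  have cnt: "(\<Sum>i<k. of_bool (v \<in> P i) :: int) = of_bool (v \<in> S)" for v
  proof (cases "v \<in> S")
    case True
    then obtain j where j: "j < k" "v \<in> P j" using P(1) by blast
    then have "(\<Sum>i<k. of_bool (v \<in> P i) :: int) = (\<Sum>i\<in>{j}. of_bool (v \<in> P i))"
      using P(2) by (intro sum.mono_neutral_right) (auto simp: disjoint_family_on_def)
    then show ?thesis using j True by simp
  qed (use P(1) in \<open>auto intro!: sum.neutral\<close>)
  define p where "p v = (\<Sum>i<k. \<pi> i v)" for v
  have "of_bool (tail D e \<in> S) \<le> p (head D e) - p (tail D e) \<and>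
     p (head D e) - p (tail D e) \<le> int k - of_bool (head D e \<in> S)" if e: "e \<in> arcs D" for e
  proof
    show "of_bool (tail D e \<in> S) \<le> p (head D e) - p (tail D e)"
      unfolding cnt[symmetric] p_def sum_subtractf[symmetric] using lo e by (intro sum_mono) auto
    have "p (head D e) - p (tail D e) \<le> (\<Sum>i<k. 1 - of_bool (head D e \<in> P i))"
      unfolding p_def sum_subtractf[symmetric, of "\<lambda>i. \<pi> i (head D e)"]
      using up e by (intro sum_mono) auto
    then show "p (head D e) - p (tail D e) \<le> int k - of_bool (head D e \<in> S)"
      by (simp add: sum_subtractf cnt)
  qed
  then show "\<exists>p :: 'a \<Rightarrow> int. \<forall>e \<in> arcs D.
     of_bool (tail D e \<in> S) \<le> p (head D e) - p (tail D e) \<and>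
     p (head D e) - p (tail D e) \<le> int k - of_bool (head D e \<in> S)" by blast
next
  assume "\<exists>p :: 'a \<Rightarrow> int. \<forall>e \<in> arcs D.
     of_bool (tail D e \<in> S) \<le> p (head D e) - p (tail D e) \<and>
     p (head D e) - p (tail D e) \<le> int k - of_bool (head D e \<in> S)"
  then obtain p :: "'a \<Rightarrow> int" where
    lo: "\<And>e. e \<in> arcs D \<Longrightarrow> of_bool (tail D e \<in> S) \<le> p (head D e) - p (tail D e)" and
    up: "\<And>e. e \<in> arcs D \<Longrightarrow> p (head D e) - p (tail D e) \<le> int k - of_bool (head D e \<in> S)"
    by blast
  \<comment> \<open>the number \<open>i < k\<close> for which \<open>p v + i\<close> is congruent to \<open>-1\<close>\<close>
  define cl where "cl v = nat ((- 1 - p v) mod int k)" for v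
  have cl: "cl v < k" for v using k by (simp add: cl_def nat_less_iff)
  define P where "P i = {v \<in> S. cl v = i}" for i
  define \<pi> where "\<pi> i v = (p v + int i) div int k" for i v
  have quot: "p v + int (cl v) = int k * \<pi> (cl v) v + (int k - 1)" for v
  proof -
    have "(p v + int (cl v)) mod int k = (- 1) mod int k"
      using k by (simp add: cl_def mod_simps)
    also have "\<dots> = int k - 1" using k by (simp add: zmod_minus1)
    finally show ?thesis
      unfolding \<pi>_def using mult_div_mod_eq[of "int k" "p v + int (cl v)"] by simp
  qed
  have "sink_stable D (P i)" for i
  proof -
    have "P i \<subseteq> verts D" using S by (auto simp: P_def)
    moreover have "of_bool (tail D e \<in> P i) \<le> \<pi> i (head D e) - \<pi> i (tail D e) \<and>
      \<pi> i (head D e) - \<pi> i (tail D e) \<le> 1 - of_bool (head D e \<in> P i)" if e: "e \<in> arcs D" for e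
    proof
      let ?u = "tail D e" and ?v = "head D e"
      have mono: "\<pi> i ?u \<le> \<pi> i ?v"
        unfolding \<pi>_def using lo[OF e] k by (intro zdiv_mono1) (auto split: if_splits simp: of_bool_def)
      have "\<pi> i ?v \<le> (p ?u + int i + int k) div int k"
        unfolding \<pi>_def using up[OF e] k by (intro zdiv_mono1) (auto split: if_splits simp: of_bool_def)
      then have le1: "\<pi> i ?v \<le> \<pi> i ?u + 1" using k by (simp add: \<pi>_def)
      show "of_bool (?u \<in> P i) \<le> \<pi> i ?v - \<pi> i ?u"
      proof (cases "?u \<in> P i")
        case True
        then have u: "cl ?u = i" "?u \<in> S" by (auto simp: P_def)
        have "int k * (\<pi> i ?u + 1) \<le> p ?v + int i"
          using quot[of ?u] u lo[OF e] by (simp add: algebra_simps)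
        then have "(int k * (\<pi> i ?u + 1)) div int k \<le> \<pi> i ?v"
          unfolding \<pi>_def[of i ?v] using k by (intro zdiv_mono1) auto
        then show ?thesis using k True by simp
      qed (use mono in simp)
      show "\<pi> i ?v - \<pi> i ?u \<le> 1 - of_bool (?v \<in> P i)"
      proof (cases "?v \<in> P i")
        case True
        then have v: "cl ?v = i" "?v \<in> S" by (auto simp: P_def)
        have "int k * \<pi> i ?v \<le> p ?u + int i"
          using quot[of ?v] v up[OF e] by (simp add: algebra_simps)
        then have "(int k * \<pi> i ?v) div int k \<le> \<pi> i ?u"
          unfolding \<pi>_def[of i ?u] using k by (intro zdiv_mono1) auto
        then show ?thesis using k True by simp
      qed (use le1 in simp)
    qed
    ultimately show ?thesis using sink_stable_iff_potential[OF fin] by blast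
  qed
  moreover have "(\<Union>i<k. P i) = S" using cl by (auto simp: P_def)
  moreover have "disjoint_family_on P {..<k}" by (auto simp: P_def disjoint_family_on_def)
  ultimately show "k_sink_stable D k S" unfolding k_sink_stable_def by blast
qed

section \<open>Circuits and their traversals\<close>

lemma cas_iff_nth:
  "pre_digraph.cas G u p v \<longleftrightarrow> (if p = [] then u = v else
     tail G (hd p) = u \<and> head G (last p) = v \<and>
     (\<forall>i. Suc i < length p \<longrightarrow> head G (p ! i) = tail G (p ! Suc i)))"
proof (induction p arbitrary: u)
  case (Cons d p)
  show ?case
  proof (cases p)
    case (Cons d' q)
    have "(\<forall>i. Suc i < length (d # p) \<longrightarrow> head G ((d # p) ! i) = tail G ((d # p) ! Suc i)) \<longleftrightarrow>
      head G d = tail G d' \<and> (\<forall>i. Suc i < length p \<longrightarrow> head G (p ! i) = tail G (p ! Suc i))"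
      (is "(\<forall>i. ?P i) \<longleftrightarrow> ?R")
    proof -
      have "(\<forall>i. ?P i) \<longleftrightarrow> ?P 0 \<and> (\<forall>i. ?P (Suc i))" by (metis not0_implies_Suc)
      then show ?thesis using Cons by simp
    qed
    with Cons.IH Cons show ?thesis by (auto simp: pre_digraph.cas.simps)
  qed (auto simp: pre_digraph.cas.simps)
qed (auto simp: pre_digraph.cas.simps)

lemma closed_walk_iff_nth:
  "(\<exists>u. pre_digraph.cas G u p u) \<longleftrightarrow>
     (\<forall>i < length p. head G (p ! i) = tail G (p ! (Suc i mod length p)))"
proof (cases "p = []")
  case False
  then obtain n where n: "length p = Suc n" by (cases p) auto
  have ends: "hd p = p ! 0" "last p = p ! n"
    using False n by (auto simp: hd_conv_nth last_conv_nth)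
  have "(\<forall>i < length p. head G (p ! i) = tail G (p ! (Suc i mod length p))) \<longleftrightarrow>
    head G (p ! n) = tail G (p ! 0) \<and> (\<forall>i < n. head G (p ! i) = tail G (p ! Suc i))"
  proof -
    have "Suc i mod Suc n = Suc i" if "i < n" for i using that by (intro mod_less) simp
    then show ?thesis unfolding n All_less_Suc by (simp cong: imp_cong)
  qed
  moreover have "(\<exists>u. pre_digraph.cas G u p u) \<longleftrightarrow>
    head G (p ! n) = tail G (p ! 0) \<and> (\<forall>i < n. head G (p ! i) = tail G (p ! Suc i))"
    unfolding cas_iff_nth using False by (simp add: n ends)
  ultimately show ?thesis by blast
qed (simp add: pre_digraph.cas.simps)

lemma traversal_iff_closed_walk:
  "traversal C w \<longleftrightarrow> distinct (map fst w) \<and> fst ` set w = arcs C \<and>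
     (\<exists>u. pre_digraph.cas (bidirected C) u w u)"
  unfolding traversal_def closed_walk_iff_nth bidirected_simps set_map by (rule refl)

lemma traversal_telescope:
  fixes \<phi> :: "'a \<Rightarrow> int"
  assumes "traversal C w"
  shows "(\<Sum>d\<in>set w. \<phi> (step_end C d) - \<phi> (step_start C d)) = 0"
proof -
  obtain u where u: "pre_digraph.cas (bidirected C) u w u"
    using assms unfolding traversal_iff_closed_walk by blast
  have "distinct w" using assms unfolding traversal_def distinct_map by blast
  then show ?thesis
    using cas_telescope[OF u, of \<phi>] by (simp add: sum_list_distinct_conv_sum_set)
qed

lemma one_le_sum_of_bool_iff:
  assumes "finite A"
  shows "(1 :: int) \<le> (\<Sum>x\<in>A. of_bool (P x)) \<longleftrightarrow> (\<exists>x\<in>A. P x)"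
proof -
  have "(1 :: int) \<le> (\<Sum>x\<in>A. of_bool (P x)) \<longleftrightarrow> 0 < card (A \<inter> {x. P x})"
    using assms by (simp add: int_one_le_iff_zero_less)
  then show ?thesis using assms by (auto simp: card_gt_0_iff)
qed

text \<open>
  Whichever way a step runs, its two ends are the ends of its arc.  So the degrees that define a
  circuit can be counted along a trail.
\<close>

lemma sum_ends_of_steps:
  assumes "inj_on fst A"
  shows "(\<Sum>e\<in>fst ` A. of_bool (head C e = v) + of_bool (tail C e = v) :: int) =
    (\<Sum>d\<in>A. of_bool (step_end C d = v)) + (\<Sum>d\<in>A. of_bool (step_start C d = v))"
proof -
  have "of_bool (head C (fst d) = v) + of_bool (tail C (fst d) = v) =
    (of_bool (step_end C d = v) + of_bool (step_start C d = v) :: int)" for d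
    by (cases d) auto
  then show ?thesis
    unfolding sum.reindex[OF assms] o_def sum.distrib[symmetric] by (intro sum.cong) auto
qed

lemma degree_eq_sum:
  assumes "finite (arcs C)"
  shows "int (in_degree C v + out_degree C v) =
    (\<Sum>e\<in>arcs C. of_bool (head C e = v) + of_bool (tail C e = v))"
proof -
  have "arcs C \<inter> {e. P e} = {e \<in> arcs C. P e}" for P by blast
  then show ?thesis
    using assms unfolding in_degree_def out_degree_def in_arcs_def out_arcs_def
    by (simp add: sum.distrib of_bool_def sum.If_cases)
qed

lemma circuit_finite:
  assumes "fin_digraph D" "circuit D C"
  shows "finite (arcs C)"
proof (rule finite_subset)
  show "arcs C \<subseteq> arcs D" using assms(2) by (simp add: circuit_def subgraph_def)
  show "finite (arcs D)" using assms(1) by (rule fin_digraph.finite_arcs)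
qed

lemma circuit_degree:
  assumes "fin_digraph D" "circuit D C" "v \<in> verts C"
  shows "(\<Sum>e\<in>arcs C. of_bool (head C e = v) + of_bool (tail C e = v)) = (2 :: int)"
  using assms circuit_finite[OF assms(1,2)]
  by (simp add: degree_eq_sum[symmetric] circuit_def del: of_nat_add)

lemma circuit_same_ends:
  assumes "circuit D C"
  shows "tail C = tail D" "head C = head D" "step_start C = step_start D" "step_end C = step_end D"
proof -
  show *: "tail C = tail D" "head C = head D"
    using assms by (auto simp: circuit_def subgraph_def compatible_def)
  show "step_start C = step_start D" "step_end C = step_end D" using * by (auto simp: fun_eq_iff)
qed

text \<open>
  Steps into and out of a node balance and together use the two arc ends there, so there is one of
  each.
\<close>

lemma traversal_visits_node:
  assumes "fin_digraph D" "circuit D C" "traversal C w" "v \<in> verts C"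
  shows "v \<in> step_start C ` set w" "v \<in> step_end C ` set w"
proof -
  let ?s = "\<Sum>d\<in>set w. of_bool (step_start C d = v) :: int"
  let ?t = "\<Sum>d\<in>set w. of_bool (step_end C d = v) :: int"
  have w: "inj_on fst (set w)" "fst ` set w = arcs C"
    using assms(3) by (auto simp: traversal_def distinct_map)
  have "?t - ?s = 0"
    using traversal_telescope[OF assms(3), of "\<lambda>x. of_bool (x = v)"] by (simp add: sum_subtractf)
  moreover have "?t + ?s = 2"
    using sum_ends_of_steps[OF w(1), of C v] circuit_degree[OF assms(1,2,4)] w(2) by simp
  ultimately have "1 \<le> ?s" and t: "1 \<le> ?t" by linarith+
  then show "v \<in> step_start C ` set w"
    unfolding one_le_sum_of_bool_iff[OF finite_set] by blast
  show "v \<in> step_end C ` set w"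
    using t unfolding one_le_sum_of_bool_iff[OF finite_set] by blast
qed

lemma connected_node_set_eq:
  assumes conn: "Digraph_Component.connected C"
    and X: "x \<in> X" "X \<subseteq> verts C" "\<And>e. e \<in> arcs C \<Longrightarrow> tail C e \<in> X \<longleftrightarrow> head C e \<in> X"
  shows "X = verts C"
proof -
  have "v \<in> X" if "v \<in> verts C" for v
  proof -
    have "x \<rightarrow>\<^sup>*\<^bsub>with_proj (mk_symmetric C)\<^esub> v"
      using conn that X(1,2) by (auto simp: connected_def strongly_connected_def)
    then have "(x, v) \<in> (parcs (mk_symmetric C))\<^sup>*" using reachable_rtranclI by fastforce
    then show ?thesis
    proof (induction rule: rtrancl_induct)
      case (step y z)
      then show ?case using X(3) by (auto simp: parcs_mk_symmetric)
    qed (use X in simp)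
  qed
  then show ?thesis using X(2) by blast
qed

text \<open>
  A longest trail is closed: at the end of an open trail an odd number of arc ends is used, out of
  two, so the trail could be extended.  A closed trail uses at least two arc ends, hence all of
  them, at each of its nodes; by connectedness it has passed through all nodes and so through
  all arcs.
\<close>

lemma circuit_has_traversal:
  assumes fin: "fin_digraph D" and C: "circuit D C"
  obtains w where "traversal C w"
proof -
  have finC: "finite (arcs C)" by (rule circuit_finite[OF fin C])
  have conn: "Digraph_Component.connected C" using C by (simp add: circuit_def)
  interpret wf_digraph C using C by (simp add: circuit_def subgraph_def)
  define trail where "trail w \<longleftrightarrow> (\<exists>u v. pre_digraph.cas (bidirected C) u w v) \<and>
    distinct (map fst w) \<and> fst ` set w \<subseteq> arcs C" for w
  have bound: "length w \<le> card (arcs C)" if "trail w" for w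
  proof -
    have "length w = card (fst ` set w)"
      using that distinct_card[of "map fst w"] by (simp add: trail_def)
    then show ?thesis using that finC by (simp add: trail_def card_mono)
  qed
  have "trail []" by (simp add: trail_def pre_digraph.cas.simps)
  then have "\<exists>w. trail w \<and> (\<forall>w'. trail w' \<longrightarrow> length w' \<le> length w)"
    by (rule ex_has_greatest_nat[where b = "Suc (card (arcs C))"]) (use bound in \<open>auto simp: less_Suc_eq_le\<close>)
  then obtain w where w: "trail w" and longest: "\<And>w'. trail w' \<Longrightarrow> length w' \<le> length w"
    by blast
  obtain u v where uv: "pre_digraph.cas (bidirected C) u w v" using w by (auto simp: trail_def)
  have dist: "distinct w" and inj: "inj_on fst (set w)" and sub: "fst ` set w \<subseteq> arcs C"
    using w by (auto simp: trail_def distinct_map)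
  let ?s = "\<lambda>x. \<Sum>d\<in>set w. of_bool (step_start C d = x) :: int"
  let ?t = "\<lambda>x. \<Sum>d\<in>set w. of_bool (step_end C d = x) :: int"
  let ?ends = "\<lambda>e x. of_bool (head C e = x) + of_bool (tail C e = x) :: int"
  have balance: "?t x - ?s x = of_bool (v = x) - of_bool (u = x)" for x
    using cas_telescope[OF uv, of "\<lambda>y. of_bool (y = x)"] dist
    by (simp add: sum_list_distinct_conv_sum_set sum_subtractf)
  have used: "?t x + ?s x = (\<Sum>e\<in>fst ` set w. ?ends e x)" for x
    using sum_ends_of_steps[OF inj, of C x] by simp
  have split: "(\<Sum>e\<in>fst ` set w. ?ends e x) + (\<Sum>e\<in>arcs C - fst ` set w. ?ends e x) = 2"
    if "x \<in> verts C" for x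
    using circuit_degree[OF fin C that] sum.subset_diff[OF sub finC, of "\<lambda>e. ?ends e x"] by simp
  have extend: "(e, b) \<notin> (arcs C - fst ` set w) \<times> UNIV" if "step_start C (e, b) = v" for e b
  proof
    assume "(e, b) \<in> (arcs C - fst ` set w) \<times> UNIV"
    then have "trail (w @ [(e, b)])"
      using w uv that unfolding trail_def cas_append by (auto simp: pre_digraph.cas.simps)
    from longest[OF this] show False by simp
  qed
  have no_free: "(\<Sum>e\<in>arcs C - fst ` set w. ?ends e v) = 0"
  proof (rule sum.neutral, rule ballI)
    fix e assume "e \<in> arcs C - fst ` set w"
    then show "?ends e v = 0" using extend[of e True] extend[of e False] by auto
  qed
  have ne: "w \<noteq> []"
  proof
    assume [simp]: "w = []"
    obtain x where x: "x \<in> verts C" using conn by (auto simp: connected_def strongly_connected_def)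
    have "arcs C \<noteq> {}"
    proof
      assume "arcs C = {}"
      then show False using split[OF x] by simp
    qed
    then obtain e where "e \<in> arcs C" by blast
    then have "trail [(e, True)]" by (simp add: trail_def pre_digraph.cas.simps)
    from longest[OF this] show False by simp
  qed
  have visited: "step_start C d \<in> verts C" "step_end C d \<in> verts C" if "d \<in> set w" for d
  proof -
    have "fst d \<in> arcs C" using that sub by blast
    then have "tail C (fst d) \<in> verts C" "head C (fst d) \<in> verts C" by simp_all
    then show "step_start C d \<in> verts C" "step_end C d \<in> verts C" by (cases d; simp)+
  qed
  have "v \<in> verts C"
    using uv ne visited(2)[of "last w"] by (auto simp: cas_iff_nth)
  then have "?t v + ?s v = 2" using split[of v] no_free used[of v] by linarith
  have "u = v"
  proof (rule ccontr)
    assume "u \<noteq> v"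
    then have "of_bool (v = v) - of_bool (u = v) = (1 :: int)" by simp
    then have "2 * ?t v = 3" using balance[of v] \<open>?t v + ?s v = 2\<close> by linarith
    then show False by presburger
  qed
  then have balanced: "?t x = ?s x" for x using balance[of x] by simp
  have all_used: "e \<in> fst ` set w"
    if e: "e \<in> arcs C" and x: "x \<in> step_start C ` set w" "head C e = x \<or> tail C e = x" for e x
  proof (rule ccontr)
    assume no: "e \<notin> fst ` set w"
    have "?s x \<ge> 1"
      unfolding one_le_sum_of_bool_iff[OF finite_set] using x(1) by blast
    then have "(\<Sum>e\<in>fst ` set w. ?ends e x) \<ge> 2" using used[of x] balanced[of x] by linarith
    moreover have "(\<Sum>e\<in>arcs C - fst ` set w. ?ends e x) \<ge> ?ends e x"
      using e no finC by (intro member_le_sum) auto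
    moreover have "?ends e x \<ge> 1" using x(2) by auto
    moreover have "x \<in> verts C" using x(1) visited by blast
    ultimately show False using split[of x] by linarith
  qed
  have starts_eq_ends: "step_end C d \<in> step_start C ` set w" if "d \<in> set w" for d
  proof -
    have "?t (step_end C d) \<ge> 1"
      unfolding one_le_sum_of_bool_iff[OF finite_set] using that by blast
    then show ?thesis
      unfolding balanced one_le_sum_of_bool_iff[OF finite_set] by (metis imageI)
  qed
  have "step_start C ` set w = verts C"
  proof (rule connected_node_set_eq[OF conn, of "step_start C (hd w)"])
    show "step_start C (hd w) \<in> step_start C ` set w" using ne by simp
    show "step_start C ` set w \<subseteq> verts C" using visited by blast
    fix e assume e: "e \<in> arcs C"
    have "tail C e \<in> step_start C ` set w \<and> head C e \<in> step_start C ` set w" if "(e, b) \<in> set w" for b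
      using that starts_eq_ends[OF that] by (cases b) force+
    then show "tail C e \<in> step_start C ` set w \<longleftrightarrow> head C e \<in> step_start C ` set w"
      using all_used[OF e] by fastforce
  qed
  then have "arcs C \<subseteq> fst ` set w" using all_used tail_in_verts by blast
  then have "traversal C w"
    unfolding traversal_iff_closed_walk using w uv sub \<open>u = v\<close> by (auto simp: trail_def)
  then show ?thesis by (rule that)
qed

text \<open>
  The steps that two traversals have in common form a circulation, because the other steps of the
  two are opposite to each other and cancel.  Inside a cycle that visits each node only once this
  leaves two possibilities, nothing or the whole cycle.  So the traversal chosen in the definition
  of \<^const>\<open>eta\<close> runs like the given one, or in the opposite direction.
\<close>

lemma eta_le_backward:
  fixes C :: "('a, 'b) pre_digraph"
  assumes fin: "finite (arcs C)" and w: "traversal C w" and simple: "distinct (map (step_start C) w)"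
  shows "eta C \<le> card (backward_arcs w)"
proof -
  define w' where "w' = (SOME w. traversal C w)"
  have w': "traversal C w'" unfolding w'_def by (rule someI[of "traversal C", OF w])
  define M where "M = set w \<inter> set w'"
  have one: "e \<in> arcs C \<Longrightarrow> (e, False) \<in> set x \<longleftrightarrow> (e, True) \<notin> set x"
    and arc: "(e, b) \<in> set x \<Longrightarrow> e \<in> arcs C"
    if x: "traversal C x" for x e b
  proof -
    assume "e \<in> arcs C"
    then have "e \<in> fst ` set x" using x by (simp add: traversal_def)
    then obtain d where d: "d \<in> set x" "fst d = e" by blast
    have "inj_on fst (set x)" using x by (simp add: traversal_def distinct_map)
    from inj_onD[OF this, of "(e, True)" "(e, False)"] d
    show "(e, False) \<in> set x \<longleftrightarrow> (e, True) \<notin> set x" by (cases d; cases "snd d") auto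
  next
    assume "(e, b) \<in> set x"
    then have "fst (e, b) \<in> set (map fst x)" by (simp only: set_map) (rule imageI)
    then show "e \<in> arcs C" using x by (simp add: traversal_def)
  qed
  have circ: "(\<Sum>d\<in>M. \<phi> (step_end C d) - \<phi> (step_start C d)) = 0" for \<phi> :: "'a \<Rightarrow> int"
  proof -
    let ?f = "\<lambda>d. \<phi> (step_end C d) - \<phi> (step_start C d)"
    have sub: "set w \<subseteq> arcs C \<times> UNIV" "set w' \<subseteq> arcs C \<times> UNIV" "M \<subseteq> arcs C \<times> UNIV"
      using arc[OF w] arc[OF w'] by (auto simp: M_def)
    have "2 * sum ?f M = sum ?f (set w) + sum ?f (set w')"
      unfolding sum_set_of_steps[OF fin sub(1)] sum_set_of_steps[OF fin sub(2)]
        sum_set_of_steps[OF fin sub(3)] sum_distrib_left sum.distrib[symmetric]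
    proof (rule sum.cong)
      fix e assume "e \<in> arcs C"
      from one[OF w this] one[OF w' this]
      show "2 * (of_bool ((e, True) \<in> M) * ?f (e, True) + of_bool ((e, False) \<in> M) * ?f (e, False)) =
        (of_bool ((e, True) \<in> set w) * ?f (e, True) + of_bool ((e, False) \<in> set w) * ?f (e, False)) +
        (of_bool ((e, True) \<in> set w') * ?f (e, True) + of_bool ((e, False) \<in> set w') * ?f (e, False))"
        by (auto simp: M_def)
    qed simp
    then show ?thesis using traversal_telescope[OF w, of \<phi>] traversal_telescope[OF w', of \<phi>] by simp
  qed
  show ?thesis
  proof (cases "M = {}")
    case True
    have "forward_arcs w' = backward_arcs w"
      unfolding forward_arcs_def backward_arcs_def
      using True one[OF w] one[OF w'] arc[OF w] arc[OF w'] unfolding M_def by blast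
    then show ?thesis by (simp add: eta_def Let_def w'_def[symmetric])
  next
    case False
    let ?L = "length w"
    obtain i where i: "i < ?L" "w ! i \<in> M" using False by (metis IntE M_def ex_in_conv in_set_conv_nth)
    have finM: "finite M" by (simp add: M_def)
    \<comment> \<open>A common step brings flow to its end node, which only the next step of \<open>w\<close> can take away.\<close>
    have succ: "w ! (Suc j mod ?L) \<in> M" if j: "j < ?L" "w ! j \<in> M" for j
    proof -
      let ?n = "step_end C (w ! j)"
      have "(\<Sum>d\<in>M. of_bool (step_end C d = ?n)) = (\<Sum>d\<in>M. of_bool (step_start C d = ?n) :: int)"
        using circ[of "\<lambda>x. of_bool (x = ?n)"] by (simp add: sum_subtractf)
      moreover have "(\<Sum>d\<in>M. of_bool (step_end C d = ?n)) \<ge> (1 :: int)"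
        unfolding one_le_sum_of_bool_iff[OF finM] using j(2) by blast
      ultimately have "(\<Sum>d\<in>M. of_bool (step_start C d = ?n)) \<ge> (1 :: int)" by simp
      then obtain d where d: "d \<in> M" "step_start C d = ?n"
        unfolding one_le_sum_of_bool_iff[OF finM] by blast
      have "w ! (Suc j mod ?L) \<in> set w"
        by (intro nth_mem mod_less_divisor) (use j(1) in linarith)
      moreover have "step_start C (w ! (Suc j mod ?L)) = ?n" using w j by (simp add: traversal_def)
      ultimately have "d = w ! (Suc j mod ?L)"
        using simple d unfolding M_def distinct_map by (metis IntE inj_onD)
      then show ?thesis using d by simp
    qed
    have orbit: "w ! ((i + n) mod ?L) \<in> M" for n
    proof (induction n)
      case (Suc n)
      have "(i + n) mod ?L < ?L" by (intro mod_less_divisor) (use i(1) in linarith)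
      from succ[OF this Suc] show ?case by (simp add: mod_Suc_eq)
    qed (use i in simp)
    have "w ! j \<in> M" if "j < ?L" for j
      using orbit[of "?L - i + j"] i that by simp
    then have "set w \<subseteq> set w'" by (metis IntE M_def in_set_conv_nth subsetI)
    then have "backward_arcs w' = backward_arcs w"
      unfolding backward_arcs_def using one[OF w] one[OF w'] arc[OF w'] by blast
    then show ?thesis by (simp add: eta_def Let_def w'_def[symmetric])
  qed
qed

text \<open>
  Around a circuit the changes of the potential add up to zero.  A forward step starting in \<open>S\<close>
  gains at least one, every backward step loses at most \<open>k\<close>, and one less if it starts in \<open>S\<close>;
  so \<open>k\<close> times the number of backward steps is at least the number of nodes in \<open>S\<close>.  The upper
  bounds on the changes give the same for the forward steps.
\<close>

lemma card_inter_circuit_le: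
  fixes D :: "('a, 'b) pre_digraph" and p :: "'a \<Rightarrow> int"
  assumes fin: "fin_digraph D" and C: "circuit D C"
    and lo: "\<And>e. e \<in> arcs D \<Longrightarrow> of_bool (tail D e \<in> S) \<le> p (head D e) - p (tail D e)"
    and up: "\<And>e. e \<in> arcs D \<Longrightarrow> p (head D e) - p (tail D e) \<le> int k - of_bool (head D e \<in> S)"
  shows "card (S \<inter> verts C) \<le> k * eta C"
proof -
  define w where "w = (SOME w. traversal C w)"
  have w: "traversal C w"
    unfolding w_def using circuit_has_traversal[OF fin C] by (metis someI)
  have arc: "fst d \<in> arcs D" if "d \<in> set w" for d
  proof -
    have "fst d \<in> arcs C" using w that unfolding traversal_def by force
    then show ?thesis using C by (auto simp: circuit_def subgraph_def)
  qed
  have card_dir: "(\<Sum>d\<in>set w. of_bool (snd d = b) :: int) = int (card {e. (e, b) \<in> set w})" for b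
  proof -
    have "{d \<in> set w. snd d = b} = (\<lambda>e. (e, b)) ` {e. (e, b) \<in> set w}" by force
    then have "card {d \<in> set w. snd d = b} = card {e. (e, b) \<in> set w}"
      by (simp add: card_image inj_on_def)
    then show ?thesis by (simp add: Int_def)
  qed
  have card_nodes: "int (card (S \<inter> verts C)) \<le> (\<Sum>d\<in>set w. of_bool (g d \<in> S))"
    if "\<And>v. v \<in> verts C \<Longrightarrow> v \<in> g ` set w" for g
  proof -
    have "S \<inter> verts C \<subseteq> g ` {d \<in> set w. g d \<in> S}" using that by blast
    then have "card (S \<inter> verts C) \<le> card (g ` {d \<in> set w. g d \<in> S})" by (intro card_mono) auto
    also have "\<dots> \<le> card {d \<in> set w. g d \<in> S}" by (rule card_image_le) simp
    finally have "card (S \<inter> verts C) \<le> card {d \<in> set w. g d \<in> S}" .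
    then show ?thesis by (simp add: Int_def)
  qed
  note same = circuit_same_ends[OF C]
  have "(\<Sum>d\<in>set w. of_bool (step_start C d \<in> S) - int k * of_bool (snd d = False)) \<le>
      (\<Sum>d\<in>set w. p (step_end C d) - p (step_start C d))"
  proof (rule sum_mono)
    fix d assume d: "d \<in> set w"
    show "of_bool (step_start C d \<in> S) - int k * of_bool (snd d = False) \<le> p (step_end C d) - p (step_start C d)"
      using lo[OF arc[OF d]] up[OF arc[OF d]] by (cases d; cases "snd d") (auto simp: same)
  qed
  then have "(\<Sum>d\<in>set w. of_bool (step_start C d \<in> S)) \<le> int k * (\<Sum>d\<in>set w. of_bool (snd d = False))"
    using traversal_telescope[OF w, of p] unfolding sum_subtractf sum_distrib_left[symmetric] by linarith
  then have "int (card (S \<inter> verts C)) \<le> int k * int (card (backward_arcs w))"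
    unfolding card_dir backward_arcs_def
    using card_nodes[OF traversal_visits_node(1)[OF fin C w]] by linarith
  then have b: "card (S \<inter> verts C) \<le> k * card (backward_arcs w)" by (simp only: of_nat_mult[symmetric] of_nat_le_iff)
  have "(\<Sum>d\<in>set w. p (step_end C d) - p (step_start C d)) \<le>
      (\<Sum>d\<in>set w. int k * of_bool (snd d = True) - of_bool (step_end C d \<in> S))"
  proof (rule sum_mono)
    fix d assume d: "d \<in> set w"
    show "p (step_end C d) - p (step_start C d) \<le> int k * of_bool (snd d = True) - of_bool (step_end C d \<in> S)"
      using lo[OF arc[OF d]] up[OF arc[OF d]] by (cases d; cases "snd d") (auto simp: same)
  qed
  then have "(\<Sum>d\<in>set w. of_bool (step_end C d \<in> S)) \<le> int k * (\<Sum>d\<in>set w. of_bool (snd d = True))"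
    using traversal_telescope[OF w, of p] unfolding sum_subtractf sum_distrib_left[symmetric] by linarith
  then have "int (card (S \<inter> verts C)) \<le> int k * int (card (forward_arcs w))"
    unfolding card_dir forward_arcs_def
    using card_nodes[OF traversal_visits_node(2)[OF fin C w]] by linarith
  then have f: "card (S \<inter> verts C) \<le> k * card (forward_arcs w)" by (simp only: of_nat_mult[symmetric] of_nat_le_iff)
  show ?thesis using b f by (simp add: eta_def Let_def w_def[symmetric] min_def)
qed

section \<open>Circuits from circulations\<close>

text \<open>
  A simple cycle of steps leaves each of its nodes once, so by balance it also enters it once, and
  these two steps use different arc ends as no arc is used in both directions.
\<close>

lemma circuit_of_simple_cycle:
  fixes D :: "('a, 'b) pre_digraph"
  assumes fin: "fin_digraph D" and w: "simple_cycle (bidirected D) w" and dist: "distinct (map fst w)"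
  obtains C where "circuit D C" "traversal C w" "verts C = step_end D ` set w"
proof -
  interpret fin_digraph D by (rule fin)
  define C where "C = \<lparr> verts = step_end D ` set w, arcs = fst ` set w, tail = tail D, head = head D \<rparr>"
  have C [simp]: "verts C = step_end D ` set w" "arcs C = fst ` set w" "tail C = tail D" "head C = head D"
    by (simp_all add: C_def)
  have same [simp]: "step_start C = step_start D" "step_end C = step_end D" by (auto simp: fun_eq_iff)
  obtain u where u: "pre_digraph.cas (bidirected D) u w u" using w by (auto simp: simple_cycle_def)
  have ne: "w \<noteq> []" and sub: "set w \<subseteq> arcs D \<times> UNIV" and starts: "inj_on (step_start D) (set w)"
    using w by (auto simp: simple_cycle_def distinct_map)
  have inj: "inj_on fst (set w)" and "distinct w" using dist by (auto simp: distinct_map)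
  have balanced: "(\<Sum>d\<in>set w. of_bool (step_end D d = x)) = (\<Sum>d\<in>set w. of_bool (step_start D d = x) :: int)" for x
    using cas_telescope[OF u, of "\<lambda>y. of_bool (y = x)"] \<open>distinct w\<close>
    by (simp add: sum_list_distinct_conv_sum_set sum_subtractf)
  have nodes: "step_end D ` set w = step_start D ` set w"
  proof -
    have "x \<in> step_end D ` set w \<longleftrightarrow> (1 :: int) \<le> (\<Sum>d\<in>set w. of_bool (step_end D d = x))" for x
      unfolding one_le_sum_of_bool_iff[OF finite_set] by blast
    moreover have "x \<in> step_start D ` set w \<longleftrightarrow> (1 :: int) \<le> (\<Sum>d\<in>set w. of_bool (step_start D d = x))" for x
      unfolding one_le_sum_of_bool_iff[OF finite_set] by blast
    ultimately show ?thesis unfolding balanced by blast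
  qed
  have next_step: "step_end D (w ! i) = step_start D (w ! (Suc i mod length w))" if "i < length w" for i
    using u that closed_walk_iff_nth[of "bidirected D" w] by auto
  have ends: "tail D (fst d) \<in> step_end D ` set w" "head D (fst d) \<in> step_end D ` set w" if "d \<in> set w" for d
  proof -
    have "step_end D d \<in> step_end D ` set w" "step_start D d \<in> step_end D ` set w"
      using that nodes by blast+
    then show "tail D (fst d) \<in> step_end D ` set w" "head D (fst d) \<in> step_end D ` set w"
      by (cases d; cases "snd d"; simp)+
  qed
  have wfC: "wf_digraph C" by unfold_locales (use ends in auto)
  have "subgraph C D"
    unfolding subgraph_def compatible_def
  proof (intro conjI wfC wf_digraph)
    show "arcs C \<subseteq> arcs D" using sub by auto
    then have "fst d \<in> arcs D" if "d \<in> set w" for d using that by auto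
    then show "verts C \<subseteq> verts D"
      using head_in_verts tail_in_verts by fastforce
  qed simp_all
  moreover have "in_degree C x + out_degree C x = 2" if "x \<in> verts C" for x
  proof -
    have "x \<in> step_start D ` set w" using that nodes by simp
    then obtain d where d: "d \<in> set w" "step_start D d = x" by blast
    have "(\<Sum>d\<in>set w. of_bool (step_start D d = x) :: int) = (\<Sum>d'\<in>{d}. of_bool (step_start D d' = x))"
      using d starts by (intro sum.mono_neutral_right) (auto dest: inj_onD)
    then have "(\<Sum>d\<in>set w. of_bool (step_start D d = x) :: int) = 1" using d by simp
    then have "int (in_degree C x + out_degree C x) = 2"
      using sum_ends_of_steps[OF inj, of C x] balanced[of x] by (subst degree_eq_sum) simp_all
    then show ?thesis by linarith
  qed
  moreover have "Digraph_Component.connected C"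
  proof -
    interpret S: wf_digraph "with_proj (mk_symmetric C)"
      unfolding wf_digraph_wp_iff by (rule wf_digraph.wellformed_mk_symmetric[OF wfC])
    let ?x = "step_start D (w ! 0)"
    have reach: "?x \<rightarrow>\<^sup>*\<^bsub>with_proj (mk_symmetric C)\<^esub> step_start D (w ! i)" if "i < length w" for i
      using that
    proof (induction i)
      case 0
      have "?x \<in> verts C" using 0 nodes by simp
      then show ?case by simp
    next
      case (Suc i)
      have "fst (w ! i) \<in> arcs C" using Suc.prems by simp
      moreover have "step_end D (w ! i) = step_start D (w ! Suc i)"
        using next_step[of i] Suc.prems by (simp only: mod_less)
      ultimately have "(step_start D (w ! i), step_start D (w ! Suc i)) \<in> parcs (mk_symmetric C)"
        unfolding parcs_mk_symmetric by (cases "w ! i"; cases "snd (w ! i)") force+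
      then have "step_start D (w ! i) \<rightarrow>\<^bsub>with_proj (mk_symmetric C)\<^esub> step_start D (w ! Suc i)" by simp
      with Suc.IH[OF Suc_lessD[OF Suc.prems]] show ?case by (rule S.reachable_adj_trans)
    qed
    have from_x: "?x \<rightarrow>\<^sup>*\<^bsub>with_proj (mk_symmetric C)\<^esub> v" if v: "v \<in> verts C" for v
    proof -
      have "v \<in> step_start D ` set w" using v nodes by simp
      then obtain i where "i < length w" "v = step_start D (w ! i)" by (metis imageE in_set_conv_nth)
      then show ?thesis using reach by simp
    qed
    then have "v \<rightarrow>\<^sup>*\<^bsub>with_proj (mk_symmetric C)\<^esub> v'" if "v \<in> verts C" "v' \<in> verts C" for v v'
      using that symmetric_reachable[OF symmetric_mk_symmetric from_x] S.reachable_trans by blast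
    moreover have "verts C \<noteq> {}" using ne by simp
    ultimately show ?thesis by (simp add: connected_def strongly_connected_def)
  qed
  ultimately have "circuit D C" by (simp add: circuit_def)
  moreover have "traversal C w" using dist next_step by (simp add: traversal_def)
  ultimately show ?thesis using that by simp
qed

lemma finite_circuits:
  assumes "fin_digraph D"
  shows "finite {C. circuit D C}"
proof (rule finite_subset)
  interpret fin_digraph D by fact
  let ?mk = "\<lambda>(V, A). \<lparr> verts = V, arcs = A, tail = tail D, head = head D \<rparr>"
  show "finite (?mk ` (Pow (verts D) \<times> Pow (arcs D)))" by simp
  show "{C. circuit D C} \<subseteq> ?mk ` (Pow (verts D) \<times> Pow (arcs D))"
  proof
    fix C assume "C \<in> {C. circuit D C}"
    then have "C = ?mk (verts C, arcs C)" "(verts C, arcs C) \<in> Pow (verts D) \<times> Pow (arcs D)"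
      by (auto simp: circuit_def subgraph_def compatible_def)
    then show "C \<in> ?mk ` (Pow (verts D) \<times> Pow (arcs D))" by (rule image_eqI)
  qed
qed

lemma circulation_subtract:
  fixes G :: "('n, 'd) pre_digraph"
  assumes fin: "finite (arcs G)" and X: "circulation G X" and A: "A \<subseteq> arcs G" "\<And>d. d \<in> A \<Longrightarrow> X d > 0"
    and bal: "\<And>\<phi> :: 'n \<Rightarrow> int. (\<Sum>d\<in>A. \<phi> (head G d) - \<phi> (tail G d)) = 0"
  shows "circulation G (\<lambda>d. X d - of_bool (d \<in> A))"
  unfolding circulation_def
proof
  fix \<phi> :: "'n \<Rightarrow> int"
  let ?f = "\<lambda>d. \<phi> (head G d) - \<phi> (tail G d)"
  have "int (X d - of_bool (d \<in> A)) = int (X d) - of_bool (d \<in> A)" for d using A(2)[of d] by auto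
  then have "(\<Sum>d\<in>arcs G. int (X d - of_bool (d \<in> A)) * ?f d) =
      (\<Sum>d\<in>arcs G. int (X d) * ?f d) - (\<Sum>d\<in>arcs G. of_bool (d \<in> A) * ?f d)"
    by (simp only: left_diff_distrib sum_subtractf)
  also have "(\<Sum>d\<in>arcs G. of_bool (d \<in> A) * ?f d) = sum ?f A"
    using fin A(1) by (intro sum.mono_neutral_cong_right) auto
  also have "\<dots> = 0" by (rule bal)
  finally show "(\<Sum>d\<in>arcs G. int (X d - of_bool (d \<in> A)) * ?f d) = 0"
    using X by (simp add: circulation_def)
qed

text \<open>
  Parts are split off the circulation until nothing is left.  A pair of opposite steps through one
  arc costs \<open>k\<close> and covers at most two nodes, so since \<open>k \<ge> 2\<close> it can be dropped at the price of
  leaving these nodes uncovered.  If there is no such pair, a simple cycle in the support is a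
  traversal of a circuit, and its backward steps pay for \<open>k\<close> times \<open>eta\<close> of that circuit.  Removing
  the nodes of the part from \<open>U\<close> makes the induction independent of how the rest covers them.
\<close>

lemma circuits_from_circulation:
  fixes D :: "('a, 'b) pre_digraph"
  assumes fin: "fin_digraph D" and k: "k \<ge> 2" and finU: "finite U"
    and X: "circulation (bidirected D) X"
  shows "\<exists>\<C> \<subseteq> {C. circuit D C}. k * (\<Sum>C\<in>\<C>. eta C) + card (U - (\<Union>C\<in>\<C>. verts C)) \<le>
    k * (\<Sum>e\<in>arcs D. X (e, False)) + card {v \<in> U. \<forall>d\<in>in_arcs (bidirected D) v. X d = 0}"
  using X finU
proof (induction "\<Sum>d\<in>arcs (bidirected D). X d" arbitrary: X U rule: less_induct)
  case less
  interpret fin_digraph D by (rule fin)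
  let ?B = "bidirected D"
  let ?uncov = "\<lambda>X U. {v \<in> U. \<forall>d\<in>in_arcs ?B v. X d = 0}"
  have finB: "finite (arcs ?B)" by simp
  have split_off: "\<exists>\<C> \<subseteq> {C. circuit D C}.
      k * (\<Sum>C\<in>\<C>. eta C) + card (U - step_end D ` A - (\<Union>C\<in>\<C>. verts C)) + k * card {e. (e, False) \<in> A} \<le>
      k * (\<Sum>e\<in>arcs D. X (e, False)) + card (?uncov X U)"
    if A: "A \<subseteq> arcs ?B" "A \<noteq> {}" "\<And>d. d \<in> A \<Longrightarrow> X d > 0"
      and bal: "\<And>\<phi> :: 'a \<Rightarrow> int. (\<Sum>d\<in>A. \<phi> (head ?B d) - \<phi> (tail ?B d)) = 0" for A
  proof -
    define Y where "Y d = X d - of_bool (d \<in> A)" for d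
    have XY: "X d = Y d + of_bool (d \<in> A)" for d using A(3)[of d] by (auto simp: Y_def)
    have "circulation ?B Y"
      unfolding Y_def by (rule circulation_subtract[OF finB less.prems(1) A(1,3) bal])
    moreover have "(\<Sum>d\<in>arcs ?B. Y d) < (\<Sum>d\<in>arcs ?B. X d)"
    proof (rule sum_strict_mono_ex1[OF finB])
      show "\<exists>d\<in>arcs ?B. Y d < X d" using A(1,2) by (auto simp: XY)
    qed (simp add: XY)
    ultimately obtain \<C> where \<C>: "\<C> \<subseteq> {C. circuit D C}"
      "k * (\<Sum>C\<in>\<C>. eta C) + card (U - step_end D ` A - (\<Union>C\<in>\<C>. verts C)) \<le>
        k * (\<Sum>e\<in>arcs D. Y (e, False)) + card (?uncov Y (U - step_end D ` A))"
      using less.hyps[of Y "U - step_end D ` A"] less.prems(2) by blast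
    have "?uncov Y (U - step_end D ` A) \<subseteq> ?uncov X U"
    proof
      fix v assume v: "v \<in> ?uncov Y (U - step_end D ` A)"
      have "X d = 0" if "d \<in> in_arcs ?B v" for d
      proof -
        have "d \<notin> A" using v that by (auto simp: in_arcs_def)
        then show ?thesis using v that by (simp add: XY)
      qed
      then show "v \<in> ?uncov X U" using v by blast
    qed
    then have "card (?uncov Y (U - step_end D ` A)) \<le> card (?uncov X U)"
      using less.prems(2) by (intro card_mono) auto
    moreover have "(\<Sum>e\<in>arcs D. of_bool ((e, False) \<in> A)) = card {e. (e, False) \<in> A}"
    proof -
      have "arcs D \<inter> {e. (e, False) \<in> A} = {e. (e, False) \<in> A}" using A(1) by auto
      then show ?thesis by simp
    qed
    then have "(\<Sum>e\<in>arcs D. X (e, False)) = (\<Sum>e\<in>arcs D. Y (e, False)) + card {e. (e, False) \<in> A}"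
      by (simp only: XY sum.distrib)
    ultimately show ?thesis using \<C> by (intro exI[of _ \<C>]) (simp add: algebra_simps)
  qed
  consider (zero) "\<And>d. d \<in> arcs ?B \<Longrightarrow> X d = 0"
    | (opposite) e where "e \<in> arcs D" "X (e, True) > 0" "X (e, False) > 0"
    | (cycle) d where "d \<in> arcs ?B" "X d > 0"
        "\<And>e. e \<in> arcs D \<Longrightarrow> X (e, True) = 0 \<or> X (e, False) = 0"
    by (metis gr0I)
  then show ?case
  proof cases
    case zero
    then have "?uncov X U = U" by (auto simp: in_arcs_def)
    then show ?thesis by (intro exI[of _ "{}"]) simp
  next
    case opposite
    let ?A = "{(e, True), (e, False)}"
    obtain \<C> where \<C>: "\<C> \<subseteq> {C. circuit D C}"
      "k * (\<Sum>C\<in>\<C>. eta C) + card (U - step_end D ` ?A - (\<Union>C\<in>\<C>. verts C)) + k * card {e'. (e', False) \<in> ?A} \<le>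
        k * (\<Sum>e\<in>arcs D. X (e, False)) + card (?uncov X U)"
      using split_off[of ?A] opposite by auto
    have "card {e'. (e', False) \<in> ?A} = 1" by simp
    moreover have "card (U - (\<Union>C\<in>\<C>. verts C)) \<le> card (U - step_end D ` ?A - (\<Union>C\<in>\<C>. verts C)) + 2"
    proof -
      have "card (U - (\<Union>C\<in>\<C>. verts C)) \<le>
          card ((U - step_end D ` ?A - (\<Union>C\<in>\<C>. verts C)) \<union> step_end D ` ?A)"
        using less.prems(2) by (intro card_mono) auto
      also have "\<dots> \<le> card (U - step_end D ` ?A - (\<Union>C\<in>\<C>. verts C)) + card (step_end D ` ?A)"
        by (rule card_Un_le)
      also have "card (step_end D ` ?A) \<le> 2" by (simp add: card_insert_if)
      finally show ?thesis by simp
    qed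
    ultimately show ?thesis using \<C> k by (intro exI[of _ \<C>]) auto
  next
    case cycle
    obtain w where w: "simple_cycle ?B w" and supp: "\<And>d. d \<in> set w \<Longrightarrow> X d > 0"
      using cycle_in_support_of_circulation[OF finB less.prems(1) cycle(1,2)] by blast
    have sub: "set w \<subseteq> arcs ?B" and ne: "set w \<noteq> {}" and distw: "distinct w"
      using w by (auto simp: simple_cycle_def distinct_map)
    have "inj_on fst (set w)"
    proof (rule inj_onI)
      fix d d' assume d: "d \<in> set w" "d' \<in> set w" "fst d = fst d'"
      then have "fst d \<in> arcs D" using sub by auto
      from cycle(3)[OF this] show "d = d'"
        using supp[OF d(1)] supp[OF d(2)] d(3) by (cases d; cases d'; cases "snd d"; cases "snd d'") auto
    qed
    then have dist: "distinct (map fst w)" using distw by (simp add: distinct_map)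
    obtain C where C: "circuit D C" "traversal C w" "verts C = step_end D ` set w"
      using circuit_of_simple_cycle[OF fin w dist] by blast
    have "distinct (map (step_start C) w)"
      using w circuit_same_ends[OF C(1)] by (simp add: simple_cycle_def)
    then have eta: "eta C \<le> card (backward_arcs w)"
      by (rule eta_le_backward[OF circuit_finite[OF fin C(1)] C(2)])
    obtain \<C> where \<C>: "\<C> \<subseteq> {C. circuit D C}"
      "k * (\<Sum>C\<in>\<C>. eta C) + card (U - step_end D ` set w - (\<Union>C\<in>\<C>. verts C)) + k * card (backward_arcs w) \<le>
        k * (\<Sum>e\<in>arcs D. X (e, False)) + card (?uncov X U)"
    proof -
      have "(\<Sum>d\<in>set w. \<phi> (head ?B d) - \<phi> (tail ?B d)) = 0" for \<phi> :: "'a \<Rightarrow> int"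
        using traversal_telescope[OF C(2), of \<phi>] circuit_same_ends[OF C(1)] by simp
      from split_off[OF sub ne supp this] show ?thesis
        using that unfolding backward_arcs_def by blast
    qed
    have fin\<C>: "finite \<C>" using \<C>(1) finite_circuits[OF fin] by (rule finite_subset)
    have "(\<Sum>C\<in>insert C \<C>. eta C) \<le> (\<Sum>C\<in>\<C>. eta C) + card (backward_arcs w)"
      using eta fin\<C> by (cases "C \<in> \<C>") (auto simp: insert_absorb)
    then have "k * (\<Sum>C\<in>insert C \<C>. eta C) \<le> k * (\<Sum>C\<in>\<C>. eta C) + k * card (backward_arcs w)"
      unfolding add_mult_distrib2[symmetric] by (rule mult_le_mono2)
    moreover have "U - (\<Union>C\<in>insert C \<C>. verts C) = U - step_end D ` set w - (\<Union>C\<in>\<C>. verts C)"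
      using C(3) by auto
    moreover have "insert C \<C> \<subseteq> {C. circuit D C}" using C(1) \<C>(1) by simp
    ultimately show ?thesis using \<C>(2) by (intro exI[of _ "insert C \<C>"]) simp
  qed
qed

section \<open>The network with split nodes\<close>

text \<open>
  Each node \<open>v\<close> becomes an entrance \<open>(v, False)\<close> and an exit \<open>(v, True)\<close>, joined by the arc
  \<open>Inl v\<close>; the steps of \<open>D\<close> lead from exits to entrances.  The flow on \<open>Inl v\<close> is then the number
  of times that a circulation of steps passes through \<open>v\<close>.
\<close>

definition split_network :: "('a, 'b) pre_digraph \<Rightarrow> ('a \<times> bool, 'a + 'b \<times> bool) pre_digraph" where
  "split_network D = \<lparr> verts = verts D \<times> UNIV, arcs = verts D <+> (arcs D \<times> UNIV),
     tail = case_sum (\<lambda>v. (v, False)) (\<lambda>d. (step_start D d, True)),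
     head = case_sum (\<lambda>v. (v, True)) (\<lambda>d. (step_end D d, False)) \<rparr>"

lemma split_network_simps [simp]:
  "arcs (split_network D) = verts D <+> (arcs D \<times> UNIV)"
  "tail (split_network D) (Inl v) = (v, False)" "head (split_network D) (Inl v) = (v, True)"
  "tail (split_network D) (Inr d) = (step_start D d, True)"
  "head (split_network D) (Inr d) = (step_end D d, False)"
  by (simp_all add: split_network_def)

lemma Inl_Inr_mem_Plus [simp]:
  "Inl x \<in> A <+> B \<longleftrightarrow> x \<in> A" "Inr y \<in> A <+> B \<longleftrightarrow> y \<in> B"
  by auto

lemma sum_split_network:
  fixes g :: "'a + 'b \<times> bool \<Rightarrow> 'm :: comm_monoid_add"
  assumes "fin_digraph D"
  shows "(\<Sum>d\<in>arcs (split_network D). g d) =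
    (\<Sum>v\<in>verts D. g (Inl v)) + (\<Sum>e\<in>arcs D. g (Inr (e, True)) + g (Inr (e, False)))"
proof -
  interpret fin_digraph D by fact
  have "(\<Sum>b\<in>UNIV. f b) = f True + f False" for f :: "bool \<Rightarrow> 'm" by (simp add: UNIV_bool add.commute)
  then have "(\<Sum>d\<in>arcs D \<times> UNIV. g (Inr d)) = (\<Sum>e\<in>arcs D. g (Inr (e, True)) + g (Inr (e, False)))"
    by (simp add: sum.cartesian_product')
  then show ?thesis by (simp add: sum.Plus)
qed

lemma circulation_of_split_network:
  fixes D :: "('a, 'b) pre_digraph"
  assumes fin: "fin_digraph D" and X: "circulation (split_network D) X"
  shows "circulation (bidirected D) (\<lambda>d. X (Inr d))"
    and "v \<in> verts D \<Longrightarrow> \<forall>d\<in>in_arcs (bidirected D) v. X (Inr d) = 0 \<Longrightarrow> X (Inl v) = 0"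
proof -
  interpret fin_digraph D by (rule fin)
  have finA: "finite (arcs (split_network D))" by simp
  show "circulation (bidirected D) (\<lambda>d. X (Inr d))"
    unfolding circulation_def
  proof
    fix \<phi> :: "'a \<Rightarrow> int"
    show "(\<Sum>d\<in>arcs (bidirected D). int (X (Inr d)) * (\<phi> (head (bidirected D) d) - \<phi> (tail (bidirected D) d))) = 0"
      using X[unfolded circulation_def, rule_format, of "\<lambda>x. \<phi> (fst x)"] by (simp add: sum.Plus)
  qed
  assume v: "v \<in> verts D" and zero: "\<forall>d\<in>in_arcs (bidirected D) v. X (Inr d) = 0"
  have "in_arcs (split_network D) (v, False) = Inr ` in_arcs (bidirected D) v"
    by (auto simp: in_arcs_def)
  moreover have "out_arcs (split_network D) (v, False) = {Inl v}"
    using v by (auto simp: out_arcs_def)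
  ultimately show "X (Inl v) = 0"
    using circulation_conservation[OF X finA, of "(v, False)"] zero by (simp add: sum.reindex)
qed

text \<open>
  The circulation minimizes \<open>k\<close> times the number of backward steps plus the number of nodes of
  \<open>U\<close> that it misses.  By the optimality criterion a missed node of \<open>U\<close> has a strictly lower
  potential at its exit than at its entrance; the nodes of \<open>U\<close> with this property form the set \<open>S\<close>.
  Among the nodes that are passed, the drop from entrance to exit is at most \<open>1\<close> at nodes of \<open>U\<close>
  passed once, and \<open>0\<close> at all others.  Weighted with the flow, the drops sum up to the rises along
  the steps carrying flow, which are \<open>k\<close> on backward and \<open>0\<close> on forward steps.  So the nodes of
  \<open>S\<close> that are passed are numerous enough to pay \<open>k\<close> for each backward step.
\<close>

lemma sink_potential_from_optimal_circulation:
  fixes D :: "('a, 'b) pre_digraph"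
  assumes fin: "fin_digraph D" and U: "U \<subseteq> verts D"
  obtains X S and p :: "'a \<Rightarrow> int" where
    "circulation (split_network D) X" "S \<subseteq> U"
    "\<And>e. e \<in> arcs D \<Longrightarrow> of_bool (tail D e \<in> S) \<le> p (head D e) - p (tail D e)"
    "\<And>e. e \<in> arcs D \<Longrightarrow> p (head D e) - p (tail D e) \<le> int k - of_bool (head D e \<in> S)"
    "k * (\<Sum>e\<in>arcs D. X (Inr (e, False))) + card {v \<in> U. X (Inl v) = 0} \<le> card S"
proof -
  interpret fin_digraph D by (rule fin)
  let ?N = "split_network D"
  have finU: "finite U" using U finite_verts by (rule finite_subset)
  have finA: "finite (arcs ?N)" by simp
  define h :: "'a + 'b \<times> bool \<Rightarrow> nat \<Rightarrow> int" where
    "h = case_sum (\<lambda>v n. of_bool (v \<in> U \<and> n = 0)) (\<lambda>d n. if snd d then 0 else int k * int n)"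
  have h: "h (Inl v) n = of_bool (v \<in> U \<and> n = 0)" "h (Inr (e, True)) n = 0"
    "h (Inr (e, False)) n = int k * int n" for v e n by (simp_all add: h_def)
  have h_nonneg: "0 \<le> h d n" for d n by (cases d) (auto simp: h_def)
  define cost where "cost X = (\<Sum>d\<in>arcs ?N. h d (X d))" for X
  have cost_nonneg: "0 \<le> cost X" for X unfolding cost_def using h_nonneg by (intro sum_nonneg)
  have "circulation ?N (\<lambda>_. 0)" by (simp add: circulation_def)
  then have "\<exists>X. circulation ?N X \<and> (\<forall>Y. circulation ?N Y \<longrightarrow> nat (cost X) \<le> nat (cost Y))"
    by (rule ex_has_least_nat[where m = "\<lambda>X. nat (cost X)"])
  then obtain X where X: "circulation ?N X"
    and opt: "\<And>Y. circulation ?N Y \<Longrightarrow> cost X \<le> cost Y"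
    using cost_nonneg by (metis nat_le_eq_zle nat_0_le zero_le_imp_eq_int)
  have convex: "h d (Suc n) - h d n \<le> h d (Suc (Suc n)) - h d (Suc n)" for d n
    by (cases d) (auto simp: h_def algebra_simps)
  obtain \<pi> :: "'a \<times> bool \<Rightarrow> int" where
    up: "\<And>d. d \<in> arcs ?N \<Longrightarrow> \<pi> (head ?N d) - \<pi> (tail ?N d) \<le> h d (Suc (X d)) - h d (X d)" and
    lo: "\<And>d. d \<in> arcs ?N \<Longrightarrow> X d > 0 \<Longrightarrow> h d (X d) - h d (X d - 1) \<le> \<pi> (head ?N d) - \<pi> (tail ?N d)"
    using optimal_circulation_potential[where G = ?N and h = h, OF finA X convex opt[unfolded cost_def]] by blast
  define S where "S = {v \<in> U. \<pi> (v, True) < \<pi> (v, False)}"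
  have S: "S \<subseteq> U" by (auto simp: S_def)
  \<comment> \<open>The sign changes because potentials of the network decrease where those of \<open>D\<close> increase.\<close>
  define p where "p v = - \<pi> (v, False)" for v
  have drop: "\<pi> (v, True) \<le> \<pi> (v, False)" if "v \<in> verts D" for v
    using up[of "Inl v"] that by (auto simp: h of_bool_def split: if_splits)
  have missed: "v \<in> S" if "v \<in> U" "X (Inl v) = 0" for v
    using up[of "Inl v"] that U by (auto simp: S_def h)
  have fwd: "\<pi> (head D e, False) \<le> \<pi> (tail D e, True)" if "e \<in> arcs D" for e
    using up[of "Inr (e, True)"] that by (simp add: h)
  have bwd: "\<pi> (tail D e, False) \<le> \<pi> (head D e, True) + int k" if "e \<in> arcs D" for e
    using up[of "Inr (e, False)"] that by (simp add: h algebra_simps)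
  have dropS: "of_bool (v \<in> S) \<le> \<pi> (v, False) - \<pi> (v, True)" if "v \<in> verts D" for v
    using drop[OF that] by (auto simp: S_def)
  have p_lo: "of_bool (tail D e \<in> S) \<le> p (head D e) - p (tail D e)" if "e \<in> arcs D" for e
    using fwd[OF that] dropS[OF tail_in_verts[OF that]] by (simp add: p_def)
  have p_up: "p (head D e) - p (tail D e) \<le> int k - of_bool (head D e \<in> S)" if "e \<in> arcs D" for e
    using bwd[OF that] dropS[OF head_in_verts[OF that]] by (simp add: p_def)
  have flow_fwd: "int (X (Inr (e, True))) * (\<pi> (head D e, False) - \<pi> (tail D e, True)) = 0"
    if "e \<in> arcs D" for e
    using fwd[OF that] lo[of "Inr (e, True)"] that by (cases "X (Inr (e, True)) > 0") (auto simp: h)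
  have flow_bwd: "int (X (Inr (e, False))) * (\<pi> (tail D e, False) - \<pi> (head D e, True)) =
      int k * int (X (Inr (e, False)))" if "e \<in> arcs D" for e
  proof (cases "X (Inr (e, False)) > 0")
    case True
    then have "int k \<le> \<pi> (tail D e, False) - \<pi> (head D e, True)"
      using lo[of "Inr (e, False)"] that by (simp add: h right_diff_distrib[symmetric] of_nat_diff)
    then have "\<pi> (tail D e, False) - \<pi> (head D e, True) = int k" using bwd[OF that] by linarith
    then show ?thesis by simp
  qed simp
  have flow_node: "int (X (Inl v)) * (\<pi> (v, False) - \<pi> (v, True)) \<le> of_bool (v \<in> S \<and> X (Inl v) \<noteq> 0)"
    if v: "v \<in> verts D" for v
  proof (cases "X (Inl v) = 0")
    case False
    then have low: "h (Inl v) (X (Inl v)) - h (Inl v) (X (Inl v) - 1) \<le> \<pi> (v, True) - \<pi> (v, False)"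
      using lo[of "Inl v"] v by simp
    show ?thesis
    proof (cases "v \<in> U \<and> X (Inl v) = 1")
      case True
      then show ?thesis using low drop[OF v] by (auto simp: h S_def)
    next
      case False
      then have "\<pi> (v, True) = \<pi> (v, False)" using low drop[OF v] \<open>X (Inl v) \<noteq> 0\<close> by (auto simp: h of_bool_def split: if_splits)
      then show ?thesis by simp
    qed
  qed simp
  have "0 = (\<Sum>d\<in>arcs ?N. int (X d) * (\<pi> (head ?N d) - \<pi> (tail ?N d)))"
    using X by (simp only: circulation_def)
  also have "\<dots> = (\<Sum>v\<in>verts D. - (int (X (Inl v)) * (\<pi> (v, False) - \<pi> (v, True)))) +
      (\<Sum>e\<in>arcs D. int k * int (X (Inr (e, False))))"
    unfolding sum_split_network[OF fin]
    by (intro arg_cong2[of _ _ _ _ "(+)"] sum.cong refl)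
      (use flow_fwd flow_bwd in \<open>auto simp: algebra_simps\<close>)
  finally have "int k * (\<Sum>e\<in>arcs D. int (X (Inr (e, False)))) =
      (\<Sum>v\<in>verts D. int (X (Inl v)) * (\<pi> (v, False) - \<pi> (v, True)))"
    by (simp add: sum_negf sum_distrib_left)
  also have "\<dots> \<le> (\<Sum>v\<in>verts D. of_bool (v \<in> S \<and> X (Inl v) \<noteq> 0))"
    by (intro sum_mono flow_node)
  also have "\<dots> = int (card {v \<in> S. X (Inl v) \<noteq> 0})"
  proof -
    have "verts D \<inter> {v. v \<in> S \<and> X (Inl v) \<noteq> 0} = {v \<in> S. X (Inl v) \<noteq> 0}" using S U by blast
    then show ?thesis by simp
  qed
  finally have "int (k * (\<Sum>e\<in>arcs D. X (Inr (e, False)))) \<le> int (card {v \<in> S. X (Inl v) \<noteq> 0})"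
    by (simp only: of_nat_mult of_nat_sum)
  then have "k * (\<Sum>e\<in>arcs D. X (Inr (e, False))) \<le> card {v \<in> S. X (Inl v) \<noteq> 0}"
    by (simp only: of_nat_le_iff)
  moreover have "card {v \<in> S. X (Inl v) \<noteq> 0} + card {v \<in> U. X (Inl v) = 0} = card S"
  proof -
    have "S = {v \<in> S. X (Inl v) \<noteq> 0} \<union> {v \<in> U. X (Inl v) = 0}"
      by (intro subset_antisym subsetI) (use S missed in auto)
    moreover have "card ({v \<in> S. X (Inl v) \<noteq> 0} \<union> {v \<in> U. X (Inl v) = 0}) =
        card {v \<in> S. X (Inl v) \<noteq> 0} + card {v \<in> U. X (Inl v) = 0}"
      using finU finite_subset[OF S finU] by (intro card_Un_disjoint) auto
    ultimately show ?thesis by simp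
  qed
  ultimately have "k * (\<Sum>e\<in>arcs D. X (Inr (e, False))) + card {v \<in> U. X (Inl v) = 0} \<le> card S"
    by linarith
  from that[OF X S p_lo p_up this] show ?thesis .
qed

section \<open>The min-max theorem\<close>

text \<open>
  The easy inequality: the part of \<open>S\<close> on each circuit is bounded by \<open>k\<close> times its \<open>eta\<close>, and the
  part outside the circuits by all nodes of \<open>U\<close> there.
\<close>

lemma card_k_sink_stable_le:
  assumes fin: "fin_digraph D" and k: "k > 0" and U: "U \<subseteq> verts D"
    and S: "S \<subseteq> U" "k_sink_stable D k S" and \<C>: "\<C> \<subseteq> {C. circuit D C}"
  shows "card S \<le> k * (\<Sum>C\<in>\<C>. eta C) + card (U - (\<Union>C\<in>\<C>. verts C))"
proof -
  interpret fin_digraph D by (rule fin)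
  have SV: "S \<subseteq> verts D" using S U by blast
  obtain p :: "'a \<Rightarrow> int" where
    p: "\<And>e. e \<in> arcs D \<Longrightarrow> of_bool (tail D e \<in> S) \<le> p (head D e) - p (tail D e)"
       "\<And>e. e \<in> arcs D \<Longrightarrow> p (head D e) - p (tail D e) \<le> int k - of_bool (head D e \<in> S)"
    using k_sink_stable_iff_potential[OF fin SV k] S(2) by blast
  have fin\<C>: "finite \<C>" using \<C> finite_circuits[OF fin] by (rule finite_subset)
  have finU: "finite U" using U finite_verts by (rule finite_subset)
  have finS: "finite S" using S(1) finU by (rule finite_subset)
  have "card S \<le> card ((\<Union>C\<in>\<C>. S \<inter> verts C) \<union> (U - (\<Union>C\<in>\<C>. verts C)))"
    using S(1) finU finS fin\<C> by (intro card_mono) auto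
  also have "\<dots> \<le> card (\<Union>C\<in>\<C>. S \<inter> verts C) + card (U - (\<Union>C\<in>\<C>. verts C))"
    by (rule card_Un_le)
  also have "card (\<Union>C\<in>\<C>. S \<inter> verts C) \<le> (\<Sum>C\<in>\<C>. card (S \<inter> verts C))"
    by (rule card_UN_le[OF fin\<C>])
  also have "\<dots> \<le> (\<Sum>C\<in>\<C>. k * eta C)"
    using \<C> card_inter_circuit_le[OF fin _ p] by (intro sum_mono) blast
  finally show ?thesis by (simp add: sum_distrib_left)
qed

theorem theorem6p7:
  fixes D :: "('a, 'b) pre_digraph" and k :: nat and U :: "'a set"
  assumes "fin_digraph D"
    and "\<forall>v \<in> verts D. \<not> isolated D v"
    and "k \<ge> 2"
    and "U \<subseteq> verts D"
  shows "Max {card S | S. S \<subseteq> U \<and> k_sink_stable D k S} =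
    Min {k * (\<Sum>C\<in>\<C>. eta C) + card (U - (\<Union>C\<in>\<C>. verts C)) | \<C>. \<C> \<subseteq> {C. circuit D C}}"
    (is "Max ?L = Min ?R")
proof -
  note fin = assms(1) and U = assms(4)
  interpret fin_digraph D by (rule fin)
  have k: "k > 0" using assms(3) by simp
  have finU: "finite U" using U finite_verts by (rule finite_subset)
  have finL: "finite ?L" using finU by simp
  have finR: "finite ?R" using finite_circuits[OF fin] by simp
  have weak: "a \<le> b" if "a \<in> ?L" "b \<in> ?R" for a b
    using that card_k_sink_stable_le[OF fin k U] by blast
  obtain X S and p :: "'a \<Rightarrow> int" where X: "circulation (split_network D) X" and S: "S \<subseteq> U"
    and p: "\<And>e. e \<in> arcs D \<Longrightarrow> of_bool (tail D e \<in> S) \<le> p (head D e) - p (tail D e)"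
      "\<And>e. e \<in> arcs D \<Longrightarrow> p (head D e) - p (tail D e) \<le> int k - of_bool (head D e \<in> S)"
    and cost: "k * (\<Sum>e\<in>arcs D. X (Inr (e, False))) + card {v \<in> U. X (Inl v) = 0} \<le> card S"
    by (rule sink_potential_from_optimal_circulation[OF fin U]) (rule that)
  have "S \<subseteq> verts D" using S U by blast
  then have "k_sink_stable D k S"
    unfolding k_sink_stable_iff_potential[OF fin _ k, OF \<open>S \<subseteq> verts D\<close>] using p by (intro exI[of _ p]) simp
  then have inL: "card S \<in> ?L" using S by blast
  obtain \<C> where \<C>: "\<C> \<subseteq> {C. circuit D C}"
    "k * (\<Sum>C\<in>\<C>. eta C) + card (U - (\<Union>C\<in>\<C>. verts C)) \<le>
      k * (\<Sum>e\<in>arcs D. X (Inr (e, False))) + card {v \<in> U. \<forall>d\<in>in_arcs (bidirected D) v. X (Inr d) = 0}"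
    using circuits_from_circulation[OF fin assms(3) finU circulation_of_split_network(1)[OF fin X]] by blast
  define b where "b = k * (\<Sum>C\<in>\<C>. eta C) + card (U - (\<Union>C\<in>\<C>. verts C))"
  have inR: "b \<in> ?R" using \<C>(1) b_def by blast
  have "card {v \<in> U. \<forall>d\<in>in_arcs (bidirected D) v. X (Inr d) = 0} \<le> card {v \<in> U. X (Inl v) = 0}"
    using finU U circulation_of_split_network(2)[OF fin X] by (intro card_mono) auto
  then have "b \<le> card S" using \<C>(2) cost b_def by linarith
  then have "b = card S" using weak[OF inL inR] by simp
  moreover have "Max ?L = card S"
    using weak inL inR \<open>b = card S\<close> finL by (intro Max_eqI) auto
  moreover have "Min ?R = b"
    using weak inL inR \<open>b = card S\<close> finR by (intro Min_eqI) auto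
  ultimately show ?thesis by simp
qed

end
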